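(* Let $K$ be a field, $R=K[[t_1,\ldots,t_m]]$, let $>$ be a $\underline{t}$-local monomial ordering on $\mathrm{Mon}^s(\underline{t},\underline{x})$ and let $G\subset K[\underline{t},\underline{x}]^s$ be finite. Then $G$ is a standard basis of $\langle G\rangle_{K[\underline{t},\underline{x}]}$ (the $K[\underline{t},\underline{x}]$-submodule of $K[\underline{t},\underline{x}]^s$ generated by $G$) if and only if $G$ is a standard basis of $\langle G\rangle_{R[\underline{x}]}$ (the $R[\underline{x}]$-submodule of $R[\underline{x}]^s$ generated by $G$).
   Context: $R[\underline{x}]=K[[t_1,\ldots,t_m]][x_1,\ldots,x_n]$ is the polynomial ring in $\underline{x}=(x_1,\ldots,x_n)$ over the formal power series ring $R$ in $\underline{t}=(t_1,\ldots,t_m)$. $\mathrm{Mon}(\underline{t},\underline{x})=\{\underline{t}^\alpha\underline{x}^\beta\mid\alpha\in\mathbb{N}^m,\beta\in\mathbb{N}^n\}$ and $\mathrm{Mon}^s(\underline{t},\underline{x})=\{\underline{t}^\alpha\underline{x}^\beta e_i\mid \alpha\in\mathbb{N}^m,\beta\in\mathbb{N}^n,1\le i\le s\}$, with $e_i$ the $i$-th unit vector. A monomial ordering on $\mathrm{Mon}(\underline{t},\underline{x})$ is a total ordering compatible with multiplication. A monomial ordering on $\mathrm{Mon}^s(\underline{t},\underline{x})$ is a total ordering $>$ such that $p>p'$ implies $\underline{t}^\alpha\underline{x}^\beta p>\underline{t}^\alpha\underline{x}^\beta p'$ for all $\alpha,\beta$, and for which there is a monomial ordering on $\mathrm{Mon}(\underline{t},\underline{x})$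 (the induced one, also denoted $>$) such that $\underline{t}^\alpha\underline{x}^\beta>\underline{t}^{\alpha'}\underline{x}^{\beta'}\Leftrightarrow\underline{t}^\alpha\underline{x}^\beta e_i>\underline{t}^{\alpha'}\underline{x}^{\beta'}e_i$ for each $i$. It is $\underline{t}$-local if $t_i<1$ for all $i=1,\ldots,m$ in the induced ordering. For $0\ne f\in R[\underline{x}]^s$, $\mathrm{lm}_>(f)$ is the largest monomial occurring in $f$ with non-zero coefficient; $\mathrm{lm}_>(0)=0$. For a subset $G\subseteq R[\underline{x}]^s$ the leading submodule is $L_>(G)=\langle\mathrm{lm}_>(f)\mid f\in G\rangle\leq K[\underline{t},\underline{x}]^s$, a module over the polynomial ring $K[\underline{t},\underline{x}]$. A standard basis of a submodule $I$ of $R[\underline{x}]^s$ (over $R[\underline{x}]$) or of $K[\underline{t},\underline{x}]^s$ (over $K[\underline{t},\underline{x}]$) is a finite subset $G\subset I$ with $L_>(G)=L_>(I)$. *)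

theory Defs
  imports HOL.Hull "HOL-Library.Poly_Mapping" "HOL-Library.Product_Plus"
begin

section \<open>Multivariate formal power series\<close>

text \<open>
  An exponent vector is a finitely supported function from variable indices to \<^typ>\<open>nat\<close>. The type
  below is the ring of formal power series in countably many variables, i.e. of all families of
  coefficients indexed by the exponent vectors; \<open>K[[t\<^sub>1,\<dots>,t\<^sub>m]]\<close> is carved out of it further down as
  the subring of the series involving only the variables with index \<open>< m\<close>. (Variables and unit
  vectors are numbered from \<open>0\<close>.)
\<close>

type_synonym expo = "nat \<Rightarrow>\<^sub>0 nat"

typedef 'a mfps = "UNIV :: (expo \<Rightarrow> 'a) set"
  morphisms mfps_nth Abs_mfps
  by simp

declare Abs_mfps_inverse [OF UNIV_I, simp]

lemma mfps_eqI: "(\<And>\<alpha>. mfps_nth f \<alpha> = mfps_nth g \<alpha>) \<Longrightarrow> f = g"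
  by (metis mfps_nth_inject ext)

definition splits :: "expo \<Rightarrow> (expo \<times> expo) set" where
  "splits \<gamma> = {(\<alpha>, \<beta>). \<alpha> + \<beta> = \<gamma>}"

lemma in_splits_iff [simp]: "(\<alpha>, \<beta>) \<in> splits \<gamma> \<longleftrightarrow> \<alpha> + \<beta> = \<gamma>"
  by (simp add: splits_def)

lemma finite_splits [simp]: "finite (splits \<gamma>)"
proof -
  let ?B = "\<Union>i\<in>Poly_Mapping.keys \<gamma>. {..Poly_Mapping.lookup \<gamma> i}"
  let ?F = "{f. \<forall>i. (i \<in> Poly_Mapping.keys \<gamma> \<longrightarrow> f i \<in> ?B) \<and> (i \<notin> Poly_Mapping.keys \<gamma> \<longrightarrow> f i = 0)}"
  let ?E = "{\<alpha>. Poly_Mapping.lookup \<alpha> \<in> ?F}"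
  have "finite ?F" by (rule finite_set_of_finite_funs) auto
  moreover have "inj (Poly_Mapping.lookup :: expo \<Rightarrow> nat \<Rightarrow> nat)"
    by (rule injI) (rule poly_mapping_eqI, simp)
  ultimately have "finite (Poly_Mapping.lookup -` ?F)" by (rule finite_vimageI)
  then have E: "finite ?E" by (simp only: vimage_def)
  have "\<alpha> \<in> ?E \<and> \<beta> \<in> ?E" if "\<alpha> + \<beta> = \<gamma>" for \<alpha> \<beta>
  proof -
    have l: "Poly_Mapping.lookup \<gamma> i = Poly_Mapping.lookup \<alpha> i + Poly_Mapping.lookup \<beta> i" for i
      using that by (metis lookup_add)
    have "Poly_Mapping.lookup \<alpha> i \<le> Poly_Mapping.lookup \<gamma> i"
         "Poly_Mapping.lookup \<beta> i \<le> Poly_Mapping.lookup \<gamma> i" for i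
      using l[of i] by auto
    moreover have "Poly_Mapping.lookup \<alpha> i = 0 \<and> Poly_Mapping.lookup \<beta> i = 0"
      if "i \<notin> Poly_Mapping.keys \<gamma>" for i
      using that l[of i] by (simp add: in_keys_iff)
    ultimately show ?thesis by blast
  qed
  then have "splits \<gamma> \<subseteq> ?E \<times> ?E" unfolding splits_def by blast
  with E show ?thesis using finite_subset by blast
qed

instantiation mfps :: (zero) zero
begin
definition zero_mfps_def: "0 = Abs_mfps (\<lambda>_. 0)"
instance ..
end

lemma mfps_nth_zero [simp]: "mfps_nth 0 \<alpha> = 0"
  by (simp add: zero_mfps_def)

instantiation mfps :: (comm_ring_1) comm_ring_1
begin

definition one_mfps_def: "1 = Abs_mfps (\<lambda>\<alpha>. if \<alpha> = 0 then 1 else 0)"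

definition plus_mfps_def: "f + g = Abs_mfps (\<lambda>\<alpha>. mfps_nth f \<alpha> + mfps_nth g \<alpha>)"

definition minus_mfps_def: "f - g = Abs_mfps (\<lambda>\<alpha>. mfps_nth f \<alpha> - mfps_nth g \<alpha>)"

definition uminus_mfps_def: "- f = Abs_mfps (\<lambda>\<alpha>. - mfps_nth f \<alpha>)"

definition times_mfps_def:
  "f * g = Abs_mfps (\<lambda>\<gamma>. \<Sum>(\<alpha>, \<beta>)\<in>splits \<gamma>. mfps_nth f \<alpha> * mfps_nth g \<beta>)"

instance
proof
  fix f g h :: "'a mfps"
  note defs = one_mfps_def plus_mfps_def minus_mfps_def uminus_mfps_def times_mfps_def
  show "f + g + h = f + (g + h)" "f + g = g + f" "0 + f = f" "- f + f = 0" "f - g = f + - g"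
    by (auto intro!: mfps_eqI simp: defs)
  show "(0::'a mfps) \<noteq> 1"
  proof
    assume "(0::'a mfps) = 1"
    then have "mfps_nth (0::'a mfps) 0 = mfps_nth 1 0" by simp
    then show False by (simp add: defs)
  qed
  show "f * g = g * f"
  proof (rule mfps_eqI)
    fix \<gamma>
    show "mfps_nth (f * g) \<gamma> = mfps_nth (g * f) \<gamma>"
      unfolding times_mfps_def Abs_mfps_inverse[OF UNIV_I]
      by (rule sum.reindex_bij_witness[of _ prod.swap prod.swap]) (auto simp: algebra_simps)
  qed
  show "(f + g) * h = f * h + g * h"
    by (auto intro!: mfps_eqI simp: defs sum.distrib[symmetric] algebra_simps case_prod_unfold)
  show "1 * f = f"
  proof (rule mfps_eqI)
    fix \<gamma>
    have "(\<Sum>(\<alpha>, \<beta>)\<in>splits \<gamma>. mfps_nth 1 \<alpha> * mfps_nth f \<beta>)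
        = (\<Sum>(\<alpha>, \<beta>)\<in>{(0, \<gamma>)}. mfps_nth 1 \<alpha> * mfps_nth f \<beta>)"
      by (rule sum.mono_neutral_right) (auto simp: defs split: if_splits)
    then show "mfps_nth (1 * f) \<gamma> = mfps_nth f \<gamma>" by (simp add: defs)
  qed
  show "f * g * h = f * (g * h)"
  proof (rule mfps_eqI)
    fix \<gamma>
    have "mfps_nth (f * g * h) \<gamma>
      = (\<Sum>p\<in>splits \<gamma>. \<Sum>q\<in>splits (fst p).
          mfps_nth f (fst q) * mfps_nth g (snd q) * mfps_nth h (snd p))"
      by (simp add: times_mfps_def case_prod_unfold sum_distrib_right)
    also have "\<dots> = (\<Sum>(p, q)\<in>(SIGMA p:splits \<gamma>. splits (fst p)).
          mfps_nth f (fst q) * mfps_nth g (snd q) * mfps_nth h (snd p))"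
      by (subst sum.Sigma) auto
    also have "\<dots> = (\<Sum>(p, q)\<in>(SIGMA p:splits \<gamma>. splits (snd p)).
          mfps_nth f (fst p) * (mfps_nth g (fst q) * mfps_nth h (snd q)))"
      by (rule sum.reindex_bij_witness
            [of _ "\<lambda>((a, d), (b, c)). ((a + b, c), (a, b))" "\<lambda>((d, c), (a, b)). ((a, b + c), (b, c))"])
         (auto simp: algebra_simps)
    also have "\<dots> = (\<Sum>p\<in>splits \<gamma>. \<Sum>q\<in>splits (snd p).
          mfps_nth f (fst p) * (mfps_nth g (fst q) * mfps_nth h (snd q)))"
      by (subst sum.Sigma) auto
    also have "\<dots> = mfps_nth (f * (g * h)) \<gamma>"
      by (simp add: times_mfps_def case_prod_unfold sum_distrib_left)
    finally show "mfps_nth (f * g * h) \<gamma> = mfps_nth (f * (g * h)) \<gamma>" .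
  qed
qed

end

section \<open>The rings \<open>R[x]\<close>, \<open>K[t,x]\<close> and their free modules\<close>

type_synonym 'k ser_poly = "expo \<Rightarrow>\<^sub>0 'k mfps"

definition power_series :: "nat \<Rightarrow> 'k::field mfps set" where
  "power_series m = {c. \<forall>\<alpha>. mfps_nth c \<alpha> \<noteq> 0 \<longrightarrow> Poly_Mapping.keys \<alpha> \<subseteq> {..<m}}"

definition R_x :: "nat \<Rightarrow> nat \<Rightarrow> 'k::field ser_poly set" where
  "R_x m n = {a. (\<forall>\<beta>\<in>Poly_Mapping.keys a. Poly_Mapping.keys \<beta> \<subseteq> {..<n}) \<and>
                 (\<forall>\<beta>. Poly_Mapping.lookup a \<beta> \<in> power_series m)}"

text \<open>
  \<open>K[t,x] = K[t][x]\<close> is taken as a subring of \<open>R[x]\<close>: the polynomials in \<open>x\<close> all of whose coefficients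
  are polynomials in \<open>t\<close>, that is, power series with finitely many nonzero coefficients.
\<close>

definition K_tx :: "nat \<Rightarrow> nat \<Rightarrow> 'k::field ser_poly set" where
  "K_tx m n = {a \<in> R_x m n. \<forall>\<beta>. finite {\<alpha>. mfps_nth (Poly_Mapping.lookup a \<beta>) \<alpha> \<noteq> 0}}"

type_synonym 'k ser_poly_vec = "nat \<Rightarrow>\<^sub>0 'k ser_poly"

definition free_module :: "'k::field ser_poly set \<Rightarrow> nat \<Rightarrow> 'k ser_poly_vec set" where
  "free_module A s = {v. Poly_Mapping.keys v \<subseteq> {..<s} \<and> (\<forall>i. Poly_Mapping.lookup v i \<in> A)}"

definition smult_vec :: "'k::field ser_poly \<Rightarrow> 'k ser_poly_vec \<Rightarrow> 'k ser_poly_vec" where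
  "smult_vec a v = Poly_Mapping.map ((*) a) v"

lemma lookup_smult_vec [simp]:
  "Poly_Mapping.lookup (smult_vec a v) i = a * Poly_Mapping.lookup v i"
  by (simp add: smult_vec_def Poly_Mapping.map.rep_eq when_def)

definition is_submodule :: "'k::field ser_poly set \<Rightarrow> 'k ser_poly_vec set \<Rightarrow> bool" where
  "is_submodule A M \<longleftrightarrow>
     0 \<in> M \<and> (\<forall>u\<in>M. \<forall>v\<in>M. u + v \<in> M) \<and> (\<forall>a\<in>A. \<forall>v\<in>M. smult_vec a v \<in> M)"

definition generated_submodule ::
  "'k::field ser_poly set \<Rightarrow> 'k ser_poly_vec set \<Rightarrow> 'k ser_poly_vec set" where
  "generated_submodule A S = is_submodule A hull S"

section \<open>Monomials and monomial orderings\<close>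

text \<open>
  \<open>(\<alpha>, \<beta>)\<close> stands for \<open>t\<^sup>\<alpha> x\<^sup>\<beta>\<close> and \<open>((\<alpha>, \<beta>), i)\<close> for \<open>t\<^sup>\<alpha> x\<^sup>\<beta> e\<^sub>i\<close>. Multiplication of monomials is the
  componentwise addition of exponents, and the monomial \<open>1\<close> is the pair \<^term>\<open>0 :: expo \<times> expo\<close>.
\<close>

type_synonym mon = "expo \<times> expo"
type_synonym vec_mon = "mon \<times> nat"

definition Mon :: "nat \<Rightarrow> nat \<Rightarrow> mon set" where
  "Mon m n = {(\<alpha>, \<beta>). Poly_Mapping.keys \<alpha> \<subseteq> {..<m} \<and> Poly_Mapping.keys \<beta> \<subseteq> {..<n}}"

definition vec_Mon :: "nat \<Rightarrow> nat \<Rightarrow> nat \<Rightarrow> vec_mon set" where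
  "vec_Mon m n s = Mon m n \<times> {..<s}"

definition strict_total_order_on :: "'b set \<Rightarrow> ('b \<Rightarrow> 'b \<Rightarrow> bool) \<Rightarrow> bool" where
  "strict_total_order_on S gt \<longleftrightarrow> irreflp_on S gt \<and> transp_on S gt \<and> totalp_on S gt"

definition monomial_ordering :: "nat \<Rightarrow> nat \<Rightarrow> (mon \<Rightarrow> mon \<Rightarrow> bool) \<Rightarrow> bool" where
  "monomial_ordering m n gt \<longleftrightarrow>
     strict_total_order_on (Mon m n) gt \<and>
     (\<forall>p\<in>Mon m n. \<forall>p'\<in>Mon m n. \<forall>q\<in>Mon m n. gt p p' \<longrightarrow> gt (q + p) (q + p'))"

definition induced_ordering ::
  "nat \<Rightarrow> nat \<Rightarrow> nat \<Rightarrow> (vec_mon \<Rightarrow> vec_mon \<Rightarrow> bool) \<Rightarrow> (mon \<Rightarrow> mon \<Rightarrow> bool) \<Rightarrow> bool" where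
  "induced_ordering m n s gt gt0 \<longleftrightarrow>
     monomial_ordering m n gt0 \<and>
     (\<forall>i<s. \<forall>p\<in>Mon m n. \<forall>p'\<in>Mon m n. gt0 p p' \<longleftrightarrow> gt (p, i) (p', i))"

definition vec_monomial_ordering ::
  "nat \<Rightarrow> nat \<Rightarrow> nat \<Rightarrow> (vec_mon \<Rightarrow> vec_mon \<Rightarrow> bool) \<Rightarrow> bool" where
  "vec_monomial_ordering m n s gt \<longleftrightarrow>
     strict_total_order_on (vec_Mon m n s) gt \<and>
     (\<forall>(p, i)\<in>vec_Mon m n s. \<forall>(p', j)\<in>vec_Mon m n s. \<forall>q\<in>Mon m n.
        gt (p, i) (p', j) \<longrightarrow> gt (q + p, i) (q + p', j)) \<and>
     (\<exists>gt0. induced_ordering m n s gt gt0)"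

text \<open>For \<open>s \<ge> 1\<close> the induced ordering is unique on \<^term>\<open>Mon m n\<close>.\<close>

definition t_local :: "nat \<Rightarrow> nat \<Rightarrow> nat \<Rightarrow> (vec_mon \<Rightarrow> vec_mon \<Rightarrow> bool) \<Rightarrow> bool" where
  "t_local m n s gt \<longleftrightarrow>
     (\<exists>gt0. induced_ordering m n s gt gt0 \<and> (\<forall>i<m. gt0 0 (Poly_Mapping.single i 1, 0)))"

section \<open>Leading monomials and standard bases\<close>

definition monomials :: "'k::field ser_poly_vec \<Rightarrow> vec_mon set" where
  "monomials f = {((\<alpha>, \<beta>), i).
     mfps_nth (Poly_Mapping.lookup (Poly_Mapping.lookup f i) \<beta>) \<alpha> \<noteq> 0}"

definition monomial_vec :: "vec_mon \<Rightarrow> 'k::field ser_poly_vec" where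
  "monomial_vec p = (case p of ((\<alpha>, \<beta>), i) \<Rightarrow>
     Poly_Mapping.single i (Poly_Mapping.single \<beta> (Abs_mfps (\<lambda>\<alpha>'. if \<alpha>' = \<alpha> then 1 else 0))))"

text \<open>
  The set of monomials of \<open>f\<close> may be infinite; the description operator denotes its largest element
  whenever there is one, which is the case for \<open>f \<noteq> 0\<close> and a \<open>t\<close>-local ordering.
\<close>

definition lm :: "(vec_mon \<Rightarrow> vec_mon \<Rightarrow> bool) \<Rightarrow> 'k::field ser_poly_vec \<Rightarrow> 'k ser_poly_vec" where
  "lm gt f = (if f = 0 then 0
     else monomial_vec (THE p. p \<in> monomials f \<and> (\<forall>q\<in>monomials f. q \<noteq> p \<longrightarrow> gt p q)))"

definition leading_submodule ::
  "nat \<Rightarrow> nat \<Rightarrow> (vec_mon \<Rightarrow> vec_mon \<Rightarrow> bool) \<Rightarrow> 'k::field ser_poly_vec set \<Rightarrow> 'k ser_poly_vec set" where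
  "leading_submodule m n gt G = generated_submodule (K_tx m n) (lm gt ` G)"

text \<open>
  The leading submodule is always taken over \<open>K[t,x]\<close>, so the same definition serves for
  \<open>K[t,x]\<close>-submodules and for \<open>R[x]\<close>-submodules \<open>I\<close>.
\<close>

definition standard_basis ::
  "nat \<Rightarrow> nat \<Rightarrow> (vec_mon \<Rightarrow> vec_mon \<Rightarrow> bool) \<Rightarrow> 'k::field ser_poly_vec set \<Rightarrow>
     'k ser_poly_vec set \<Rightarrow> bool" where
  "standard_basis m n gt I G \<longleftrightarrow>
     finite G \<and> G \<subseteq> I \<and> leading_submodule m n gt G = leading_submodule m n gt I"

end

theory Submission
  imports Defs "HOL-Library.Product_Lexorder" "HOL.Topological_Spaces"
begin

text \<open>
  Write \<open>I\<close> and \<open>J\<close> for the submodules generated by \<open>G\<close> over \<open>K[t,x]\<close> and over \<open>R[x]\<close>. The two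
  conditions on \<open>G\<close> are \<open>L(G) = L(I)\<close> and \<open>L(G) = L(J)\<close>, so it is enough to know \<open>L(I) = L(J)\<close>
  (lemma \<open>leading_submodule_eq\<close>): each leading monomial of an element of \<open>J\<close> is already the leading
  monomial of an element of \<open>I\<close>.

  Let \<open>f \<in> J\<close> have leading monomial \<open>p\<close>. Truncating the power series in an expression of \<open>f\<close> through
  \<open>G\<close> gives \<open>h \<in> I\<close> that agrees with \<open>f\<close> up to any prescribed order in \<open>t\<close>, and only finitely many
  pairs of an \<open>x\<close>-exponent and a component occur in all these \<open>h\<close> together
  (lemma \<open>t_adic_approximation\<close>). Still, \<open>h\<close> may have a leading monomial larger than \<open>p\<close>: for example,
  \<open>t\<^sup>N x\<^sup>2 > x\<close> is possible for all \<open>N\<close>. So look at the module \<open>F\<close> of all polynomial vectors with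
  those pairs; it is finitely generated over \<open>K[t]\<close>. As the ordering is \<open>t\<close>-local, the
  vectors in \<open>F\<close> with all monomials below \<open>p\<close> form a \<open>K[t]\<close>-submodule \<open>V\<close>, and \<open>t\<^sub>i p \<in> V\<close> for
  each \<open>i\<close>. Comparing \<open>f\<close> with \<open>h\<close> shows \<open>p \<in> (I \<inter> F) + V + t\<^sup>d F\<close> for all \<open>d\<close>, where \<open>t\<^sup>d F\<close> stands
  for the vectors of order at least \<open>d\<close> in \<open>t\<close>. A case of Krull's intersection theorem
  (lemma \<open>strip_intersection_theorem\<close>) then gives \<open>p \<in> (I \<inter> F) + V\<close>, that is, an element of \<open>I\<close>
  which is \<open>p\<close> plus smaller terms.

  The intersection theorem rests on \<open>F\<close> being a Noetherian \<open>K[t]\<close>-module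
  (lemma \<open>ascending_chain_stabilizes\<close>), which follows from Dickson's lemma by comparing leading
  monomials for the lexicographic ordering. That ordering has nothing to do with the given one: it
  is a well-ordering on the monomials of \<open>F\<close>, whereas a \<open>t\<close>-local one is never one if \<open>t\<close>
  is present.
\<close>

section \<open>Coefficients and supports\<close>

text \<open>
  Vectors are handled through their coefficient families, which are indexed by all of
  \<^typ>\<open>vec_mon\<close>. Membership in the rings and free modules becomes a condition on supports, and
  about general products only one fact is needed: their support lies in the sum of the supports.
\<close>
definition vcoeff :: "'k::field ser_poly_vec \<Rightarrow> vec_mon \<Rightarrow> 'k" where
  "vcoeff v q = mfps_nth (Poly_Mapping.lookup (Poly_Mapping.lookup v (snd q)) (snd (fst q))) (fst (fst q))"

definition supp :: "'k::field ser_poly \<Rightarrow> mon set" where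
  "supp a = {p. mfps_nth (Poly_Mapping.lookup a (snd p)) (fst p) \<noteq> 0}"

lemma monomials_iff: "q \<in> monomials v \<longleftrightarrow> vcoeff v q \<noteq> 0"
  by (cases q) (auto simp: monomials_def vcoeff_def)

lemma monomials_conv_supp: "monomials v = {q. fst q \<in> supp (Poly_Mapping.lookup v (snd q))}"
  by (auto simp: monomials_iff vcoeff_def supp_def)

lemma mfps_nth_plus [simp]: "mfps_nth (f + g) \<alpha> = mfps_nth f \<alpha> + mfps_nth g \<alpha>"
  by (simp add: plus_mfps_def)

lemma mfps_nth_minus [simp]: "mfps_nth (f - g) \<alpha> = mfps_nth f \<alpha> - mfps_nth g \<alpha>"
  by (simp add: minus_mfps_def)

lemma mfps_nth_sum: "mfps_nth (sum f A) \<alpha> = (\<Sum>a\<in>A. mfps_nth (f a) \<alpha>)"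
  by (induction A rule: infinite_finite_induct) auto

lemma vcoeff_add [simp]: "vcoeff (u + v) q = vcoeff u q + vcoeff v q"
  by (simp add: vcoeff_def lookup_add)

lemma vcoeff_diff [simp]: "vcoeff (u - v) q = vcoeff u q - vcoeff v q"
  by (simp add: vcoeff_def lookup_minus)

lemma vcoeff_zero [simp]: "vcoeff 0 q = 0"
  by (simp add: vcoeff_def)

lemma vcoeff_inject: "(\<And>q. vcoeff u q = vcoeff v q) \<Longrightarrow> u = v"
proof (intro poly_mapping_eqI mfps_eqI)
  fix i \<beta> \<alpha>
  assume "\<And>q. vcoeff u q = vcoeff v q"
  from this[of "((\<alpha>, \<beta>), i)"]
  show "mfps_nth (Poly_Mapping.lookup (Poly_Mapping.lookup u i) \<beta>) \<alpha> =
        mfps_nth (Poly_Mapping.lookup (Poly_Mapping.lookup v i) \<beta>) \<alpha>"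
    by (simp add: vcoeff_def)
qed

lemma monomials_eq_empty_iff [simp]: "monomials v = {} \<longleftrightarrow> v = 0"
  using vcoeff_inject[of v 0] by (auto simp: set_eq_iff monomials_iff)

lemma monomials_zero [simp]: "monomials 0 = {}"
  by simp

lemma monomials_add: "monomials (u + v) \<subseteq> monomials u \<union> monomials v"
  by (auto simp: monomials_iff)

lemma monomials_diff: "monomials (u - v) \<subseteq> monomials u \<union> monomials v"
  by (auto simp: monomials_iff)

lemma mfps_eq_0_iff: "f = 0 \<longleftrightarrow> (\<forall>\<alpha>. mfps_nth f \<alpha> = 0)"
  using mfps_eqI[of f 0] by auto

lemma supp_zero [simp]: "supp 0 = {}"
  by (simp add: supp_def)

lemma supp_eq_empty_iff [simp]: "supp a = {} \<longleftrightarrow> a = 0"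
proof
  assume "supp a = {}"
  then have "\<forall>\<beta> \<alpha>. mfps_nth (Poly_Mapping.lookup a \<beta>) \<alpha> = 0"
    by (simp add: supp_def set_eq_iff)
  then have "\<forall>\<beta>. Poly_Mapping.lookup a \<beta> = 0"
    by (simp add: mfps_eq_0_iff)
  then show "a = 0" by (simp add: poly_mapping_eq_iff fun_eq_iff)
qed simp

lemma supp_mult: "supp (a * b) \<subseteq> {p + q | p q. p \<in> supp a \<and> q \<in> supp b}"
proof
  fix r assume r: "r \<in> supp (a * b)"
  define S where "S l = (\<Sum>q. Poly_Mapping.lookup b q when snd r = l + q)" for l
  from r have "mfps_nth (\<Sum>l. Poly_Mapping.lookup a l * S l) (fst r) \<noteq> 0"
    by (simp add: supp_def lookup_mult S_def)
  then obtain l where "mfps_nth (Poly_Mapping.lookup a l * S l) (fst r) \<noteq> 0"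
    unfolding Sum_any.expand_set mfps_nth_sum by (blast elim: sum.not_neutral_contains_not_neutral)
  then obtain \<alpha> \<alpha>' where sp: "\<alpha> + \<alpha>' = fst r"
    and "mfps_nth (Poly_Mapping.lookup a l) \<alpha> * mfps_nth (S l) \<alpha>' \<noteq> 0"
    unfolding times_mfps_def Abs_mfps_inverse[OF UNIV_I]
    by (force elim: sum.not_neutral_contains_not_neutral)
  then have a: "mfps_nth (Poly_Mapping.lookup a l) \<alpha> \<noteq> 0" and "mfps_nth (S l) \<alpha>' \<noteq> 0"
    by auto
  then obtain q where "mfps_nth (Poly_Mapping.lookup b q when snd r = l + q) \<alpha>' \<noteq> 0"
    unfolding S_def Sum_any.expand_set mfps_nth_sum by (blast elim: sum.not_neutral_contains_not_neutral)
  then have "snd r = l + q" "mfps_nth (Poly_Mapping.lookup b q) \<alpha>' \<noteq> 0"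
    by (auto simp: when_def split: if_splits)
  with a sp have "r = (\<alpha>, l) + (\<alpha>', q)" "(\<alpha>, l) \<in> supp a" "(\<alpha>', q) \<in> supp b"
    by (auto simp: supp_def prod_eq_iff)
  then show "r \<in> {p + q | p q. p \<in> supp a \<and> q \<in> supp b}" by blast
qed

lemma monomials_smult:
  "monomials (smult_vec a v) \<subseteq> {(p + fst q, snd q) | p q. p \<in> supp a \<and> q \<in> monomials v}"
proof
  fix r assume "r \<in> monomials (smult_vec a v)"
  then have "fst r \<in> supp (a * Poly_Mapping.lookup v (snd r))"
    by (simp add: monomials_conv_supp)
  with supp_mult obtain p q where "fst r = p + q" "p \<in> supp a"
      "q \<in> supp (Poly_Mapping.lookup v (snd r))" by blast
  then have "r = (p + fst (q, snd r), snd (q, snd r))" "(q, snd r) \<in> monomials v" "p \<in> supp a"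
    by (auto simp: monomials_conv_supp prod_eq_iff)
  then show "r \<in> {(p + fst q, snd q) | p q. p \<in> supp a \<and> q \<in> monomials v}" by blast
qed

lemma smult_vec_add_right: "smult_vec a (u + v) = smult_vec a u + smult_vec a v"
  by (rule poly_mapping_eqI) (simp add: lookup_add algebra_simps)

lemma smult_vec_diff_left: "smult_vec (a - b) v = smult_vec a v - smult_vec b v"
  by (rule poly_mapping_eqI) (simp add: lookup_minus algebra_simps)

lemma smult_vec_diff_right: "smult_vec a (u - v) = smult_vec a u - smult_vec a v"
  by (rule poly_mapping_eqI) (simp add: lookup_minus algebra_simps)

lemma smult_vec_assoc: "smult_vec a (smult_vec b v) = smult_vec (a * b) v"
  by (rule poly_mapping_eqI) (simp add: algebra_simps)

lemma smult_vec_zero_right [simp]: "smult_vec a 0 = 0"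
  by (rule poly_mapping_eqI) simp

lemma R_x_iff: "a \<in> R_x m n \<longleftrightarrow> supp a \<subseteq> Mon m n"
proof -
  have "(\<exists>\<alpha>. (\<alpha>, \<beta>) \<in> supp a) \<longleftrightarrow> \<beta> \<in> Poly_Mapping.keys a" for \<beta>
    by (simp add: supp_def in_keys_iff mfps_eq_0_iff)
  then have "(\<forall>\<beta>\<in>Poly_Mapping.keys a. Poly_Mapping.keys \<beta> \<subseteq> {..<n}) \<longleftrightarrow>
      (\<forall>(\<alpha>, \<beta>)\<in>supp a. Poly_Mapping.keys \<beta> \<subseteq> {..<n})"
    by blast
  moreover have "(\<forall>\<beta>. Poly_Mapping.lookup a \<beta> \<in> power_series m) \<longleftrightarrow>
      (\<forall>(\<alpha>, \<beta>)\<in>supp a. Poly_Mapping.keys \<alpha> \<subseteq> {..<m})"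
    by (auto simp: power_series_def supp_def)
  ultimately show ?thesis
    unfolding R_x_def Mon_def by auto
qed

lemma K_tx_iff: "a \<in> K_tx m n \<longleftrightarrow> supp a \<subseteq> Mon m n \<and> finite (supp a)"
proof -
  have "supp a = (\<Union>\<beta>\<in>Poly_Mapping.keys a.
      (\<lambda>\<alpha>. (\<alpha>, \<beta>)) ` {\<alpha>. mfps_nth (Poly_Mapping.lookup a \<beta>) \<alpha> \<noteq> 0})"
  proof (intro equalityI subsetI)
    fix p assume "p \<in> supp a"
    moreover from this have "snd p \<in> Poly_Mapping.keys a"
      by (auto simp: supp_def in_keys_iff)
    ultimately show "p \<in> (\<Union>\<beta>\<in>Poly_Mapping.keys a.
      (\<lambda>\<alpha>. (\<alpha>, \<beta>)) ` {\<alpha>. mfps_nth (Poly_Mapping.lookup a \<beta>) \<alpha> \<noteq> 0})"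
      by (cases p) (auto simp: supp_def)
  qed (auto simp: supp_def)
  then have "finite (supp a)" if "\<forall>\<beta>. finite {\<alpha>. mfps_nth (Poly_Mapping.lookup a \<beta>) \<alpha> \<noteq> 0}"
    using that by simp
  moreover have "finite {\<alpha>. mfps_nth (Poly_Mapping.lookup a \<beta>) \<alpha> \<noteq> 0}" if "finite (supp a)" for \<beta>
  proof (rule finite_subset)
    show "{\<alpha>. mfps_nth (Poly_Mapping.lookup a \<beta>) \<alpha> \<noteq> 0} \<subseteq> fst ` supp a"
      by (auto simp: supp_def intro: rev_image_eqI[of "(_, \<beta>)"])
  qed (use that in simp)
  ultimately show ?thesis by (auto simp: K_tx_def R_x_iff)
qed

lemma monomials_free_module_R: 
  "v \<in> free_module (R_x m n) s \<longleftrightarrow> monomials v \<subseteq> vec_Mon m n s"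
proof -
  have "(\<exists>p. (p, i) \<in> monomials v) \<longleftrightarrow> i \<in> Poly_Mapping.keys v" for i
    using supp_eq_empty_iff[of "Poly_Mapping.lookup v i"]
    by (auto simp: monomials_conv_supp in_keys_iff simp del: supp_eq_empty_iff)
  then have "Poly_Mapping.keys v \<subseteq> {..<s} \<longleftrightarrow> (\<forall>(p, i)\<in>monomials v. i < s)"
    by blast
  moreover have "(\<forall>i. Poly_Mapping.lookup v i \<in> R_x m n) \<longleftrightarrow> (\<forall>(p, i)\<in>monomials v. p \<in> Mon m n)"
    by (auto simp: R_x_iff monomials_conv_supp)
  ultimately show ?thesis
    unfolding free_module_def vec_Mon_def by auto
qed

lemma finite_monomials_K:
  assumes "v \<in> free_module (K_tx m n) s" shows "finite (monomials v)"
proof -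
  have "monomials v = (\<Union>i\<in>Poly_Mapping.keys v. (\<lambda>p. (p, i)) ` supp (Poly_Mapping.lookup v i))"
  proof (intro equalityI subsetI)
    fix q assume "q \<in> monomials v"
    moreover from this have "snd q \<in> Poly_Mapping.keys v"
      by (auto simp: monomials_conv_supp in_keys_iff)
    ultimately show "q \<in> (\<Union>i\<in>Poly_Mapping.keys v. (\<lambda>p. (p, i)) ` supp (Poly_Mapping.lookup v i))"
      by (cases q) (auto simp: monomials_conv_supp)
  qed (auto simp: monomials_conv_supp)
  then show ?thesis using assms by (simp add: free_module_def K_tx_iff)
qed

lemma K_tx_subset_R_x: "K_tx m n \<subseteq> R_x m n"
  by (auto simp: K_tx_def)

lemma free_module_K_iff:
  "v \<in> free_module (K_tx m n) s \<longleftrightarrow> monomials v \<subseteq> vec_Mon m n s \<and> finite (monomials v)"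
proof
  assume "v \<in> free_module (K_tx m n) s"
  moreover from this have "v \<in> free_module (R_x m n) s"
    using K_tx_subset_R_x[of m n] by (auto simp: free_module_def)
  ultimately show "monomials v \<subseteq> vec_Mon m n s \<and> finite (monomials v)"
    using finite_monomials_K monomials_free_module_R by blast
next
  assume v: "monomials v \<subseteq> vec_Mon m n s \<and> finite (monomials v)"
  have "finite (supp (Poly_Mapping.lookup v i))" for i
  proof (rule finite_subset)
    show "supp (Poly_Mapping.lookup v i) \<subseteq> fst ` monomials v"
      by (auto simp: monomials_conv_supp intro: rev_image_eqI[of "(_, i)"])
  qed (use v in simp)
  with v show "v \<in> free_module (K_tx m n) s"
    using monomials_free_module_R[of v m n s] by (auto simp: free_module_def K_tx_iff R_x_iff)
qed

lemma Mon_add: "p \<in> Mon m n \<Longrightarrow> q \<in> Mon m n \<Longrightarrow> p + q \<in> Mon m n"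
  using Poly_Mapping.keys_add[of "fst p" "fst q"] Poly_Mapping.keys_add[of "snd p" "snd q"]
  by (cases p, cases q) (fastforce simp: Mon_def)

lemma monomials_smult_Mon:
  "supp a \<subseteq> Mon m n \<Longrightarrow> monomials v \<subseteq> vec_Mon m n s \<Longrightarrow> monomials (smult_vec a v) \<subseteq> vec_Mon m n s"
  using monomials_smult[of a v] Mon_add by (fastforce simp: vec_Mon_def)

lemma finite_monomials_smult:
  assumes "finite (supp a)" "finite (monomials v)"
  shows "finite (monomials (smult_vec a v))"
proof (rule finite_subset)
  show "monomials (smult_vec a v) \<subseteq> (\<lambda>(p, q). (p + fst q, snd q)) ` (supp a \<times> monomials v)"
    using monomials_smult[of a v] by (force intro: rev_image_eqI)
qed (use assms in simp)

lemma submodule_zero: "is_submodule A M \<Longrightarrow> 0 \<in> M"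
  by (simp add: is_submodule_def)

lemma submodule_add: "is_submodule A M \<Longrightarrow> u \<in> M \<Longrightarrow> v \<in> M \<Longrightarrow> u + v \<in> M"
  by (simp add: is_submodule_def)

lemma submodule_smult: "is_submodule A M \<Longrightarrow> a \<in> A \<Longrightarrow> v \<in> M \<Longrightarrow> smult_vec a v \<in> M"
  by (simp add: is_submodule_def)

lemma is_submodule_generated: "is_submodule A (generated_submodule A S)"
  unfolding generated_submodule_def by (rule hull_in) (auto simp: is_submodule_def)

lemma generated_submodule_minimal: "S \<subseteq> M \<Longrightarrow> is_submodule A M \<Longrightarrow> generated_submodule A S \<subseteq> M"
  unfolding generated_submodule_def by (rule hull_minimal)

lemma generated_submodule_superset: "S \<subseteq> generated_submodule A S"
  unfolding generated_submodule_def by (rule hull_subset)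

lemma generated_submodule_mono:
  assumes "A \<subseteq> B" shows "generated_submodule A S \<subseteq> generated_submodule B S"
proof (rule generated_submodule_minimal[OF generated_submodule_superset])
  show "is_submodule A (generated_submodule B S)"
    using is_submodule_generated[of B S] assms by (auto simp: is_submodule_def)
qed

lemma is_submodule_free_module_R: "is_submodule (R_x m n) (free_module (R_x m n) s)"
proof -
  have "monomials (u + v) \<subseteq> vec_Mon m n s"
    if "monomials u \<subseteq> vec_Mon m n s" "monomials v \<subseteq> vec_Mon m n s" for u v :: "'a ser_poly_vec"
    using that monomials_add[of u v] by blast
  then show ?thesis
    by (simp add: is_submodule_def monomials_free_module_R R_x_iff monomials_smult_Mon)
qed

lemma is_submodule_free_module_K: "is_submodule (K_tx m n) (free_module (K_tx m n) s)"
proof -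
  have "u + v \<in> free_module (K_tx m n) s"
    if "u \<in> free_module (K_tx m n) s" "v \<in> free_module (K_tx m n) s" for u v :: "'a ser_poly_vec"
  proof -
    have "finite (monomials u \<union> monomials v)" using that by (simp add: free_module_K_iff)
    then have "finite (monomials (u + v))" by (rule finite_subset[OF monomials_add])
    then show ?thesis using that monomials_add[of u v] unfolding free_module_K_iff by blast
  qed
  then show ?thesis
    by (simp add: is_submodule_def free_module_K_iff K_tx_iff monomials_smult_Mon finite_monomials_smult)
qed

section \<open>Multiplication by monomials in \<open>t\<close>\<close>

definition tmon :: "'k \<Rightarrow> expo \<Rightarrow> 'k::field ser_poly" where
  "tmon c \<delta> = Poly_Mapping.single 0 (Abs_mfps (\<lambda>\<alpha>. if \<alpha> = \<delta> then c else 0))"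

definition tshift :: "expo \<Rightarrow> vec_mon \<Rightarrow> vec_mon" where
  "tshift \<delta> q = ((\<delta> + fst (fst q), snd (fst q)), snd q)"

lemma tshift_0 [simp]: "tshift 0 q = q"
  by (simp add: tshift_def)

lemma tshift_tshift: "tshift \<gamma> (tshift \<delta> q) = tshift (\<gamma> + \<delta>) q"
  by (simp add: tshift_def add.assoc)

lemma tshift_inject [simp]: "tshift \<delta> q = tshift \<delta> r \<longleftrightarrow> q = r"
  by (auto simp: tshift_def prod_eq_iff)

lemma supp_tmon: "supp (tmon c \<delta>) \<subseteq> {(\<delta>, 0)}"
  by (auto simp: supp_def tmon_def lookup_single when_def split: if_splits)

lemma tmon_in_K_tx: "Poly_Mapping.keys \<delta> \<subseteq> {..<m} \<Longrightarrow> tmon c \<delta> \<in> K_tx m n"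
  using supp_tmon[of c \<delta>] by (auto simp: K_tx_iff Mon_def intro: finite_subset)

lemma vcoeff_tmon_shift: "vcoeff (smult_vec (tmon c \<delta>) v) (tshift \<delta> q) = c * vcoeff v q"
proof -
  let ?d = "Abs_mfps (\<lambda>\<alpha>. if \<alpha> = \<delta> then c else 0)"
  have l: "Poly_Mapping.lookup (tmon c \<delta> * b) \<beta> = ?d * Poly_Mapping.lookup b \<beta>" for b \<beta>
  proof -
    have "tmon c \<delta> * b = Poly_Mapping.map ((*) ?d) b"
      unfolding tmon_def by (simp add: mult_map_scale_conv_mult)
    then show ?thesis by (simp add: Poly_Mapping.map.rep_eq when_def)
  qed
  have "mfps_nth (?d * f) (\<delta> + \<alpha>) = c * mfps_nth f \<alpha>" for f \<alpha>
  proof -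
    have "(\<Sum>(\<alpha>', \<beta>)\<in>splits (\<delta> + \<alpha>). mfps_nth ?d \<alpha>' * mfps_nth f \<beta>)
        = (\<Sum>(\<alpha>', \<beta>)\<in>{(\<delta>, \<alpha>)}. mfps_nth ?d \<alpha>' * mfps_nth f \<beta>)"
      by (rule sum.mono_neutral_right) (auto split: if_splits)
    then show ?thesis by (simp add: times_mfps_def)
  qed
  then show ?thesis by (simp add: vcoeff_def tshift_def l)
qed

lemma monomials_tmon: "monomials (smult_vec (tmon c \<delta>) v) \<subseteq> tshift \<delta> ` monomials v"
proof
  fix r assume "r \<in> monomials (smult_vec (tmon c \<delta>) v)"
  with monomials_smult obtain p q where "r = (p + fst q, snd q)" "p \<in> supp (tmon c \<delta>)" "q \<in> monomials v"
    by blast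
  with supp_tmon show "r \<in> tshift \<delta> ` monomials v"
    by (force simp: tshift_def plus_prod_def)
qed

lemma vcoeff_tmon_0 [simp]: "vcoeff (smult_vec (tmon c 0) v) q = c * vcoeff v q"
  using vcoeff_tmon_shift[of c 0 v q] by simp

lemma vcoeff_monomial_vec: "vcoeff (monomial_vec p :: 'k::field ser_poly_vec) q = (if q = p then 1 else 0)"
  by (cases p, cases q) (auto simp: vcoeff_def monomial_vec_def lookup_single when_def split: if_splits)

lemma monomials_monomial_vec [simp]: "monomials (monomial_vec p :: 'k::field ser_poly_vec) = {p}"
  by (auto simp: monomials_iff vcoeff_monomial_vec split: if_splits)

lemma tmon_monomial_vec:
  "smult_vec (tmon c \<delta>) (monomial_vec q) = smult_vec (tmon c 0) (monomial_vec (tshift \<delta> q))"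
proof (rule vcoeff_inject)
  fix r
  let ?l = "smult_vec (tmon c \<delta>) (monomial_vec q)"
  show "vcoeff ?l r = vcoeff (smult_vec (tmon c 0) (monomial_vec (tshift \<delta> q))) r"
  proof (cases "r = tshift \<delta> q")
    case True
    then show ?thesis by (simp add: vcoeff_tmon_shift vcoeff_monomial_vec)
  next
    case False
    with monomials_tmon[of c \<delta> "monomial_vec q"] have "r \<notin> monomials ?l" by auto
    with False show ?thesis by (simp add: monomials_iff vcoeff_monomial_vec)
  qed
qed

text \<open>
  A polynomial vector is the sum of its terms. In this form membership in additively closed
  sets, such as sums of two submodules, is checked one term at a time.
\<close>
lemma monomial_terms_in_imp_in:
  assumes "finite (monomials y)" "0 \<in> M" "\<And>u v. u \<in> M \<Longrightarrow> v \<in> M \<Longrightarrow> u + v \<in> M"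
    and "\<And>q. q \<in> monomials y \<Longrightarrow> smult_vec (tmon (vcoeff y q) 0) (monomial_vec q) \<in> M"
  shows "y \<in> M"
proof -
  have "S = monomials y \<Longrightarrow>
    (\<And>q. q \<in> monomials y \<Longrightarrow> smult_vec (tmon (vcoeff y q) 0) (monomial_vec q) \<in> M) \<Longrightarrow> y \<in> M"
    if "finite S" for S y
    using that
  proof (induction S arbitrary: y rule: finite_induct)
    case empty
    with assms(2) show ?case by (metis monomials_eq_empty_iff)
  next
    case (insert q S)
    let ?t = "smult_vec (tmon (vcoeff y q) 0) (monomial_vec q)"
    have c: "vcoeff (y - ?t) r = (if r = q then 0 else vcoeff y r)" for r
      by (simp add: vcoeff_monomial_vec)
    then have "S = monomials (y - ?t)"
      using insert.prems(1) insert.hyps(2) unfolding set_eq_iff monomials_iff c by auto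
    moreover have "smult_vec (tmon (vcoeff (y - ?t) r) 0) (monomial_vec r) \<in> M"
      if "r \<in> monomials (y - ?t)" for r
      using that insert.prems(2)[of r] by (auto simp: c monomials_iff simp del: vcoeff_diff split: if_splits)
    ultimately have "y - ?t \<in> M" by (rule insert.IH)
    then have "(y - ?t) + ?t \<in> M"
      by (rule assms(3)) (use insert.prems in blast)
    then show ?case by simp
  qed
  then show ?thesis using assms(1,4) by blast
qed

section \<open>Dickson's lemma and the Noetherian property\<close>

text \<open>
  Multiplication by elements of \<open>K[t]\<close> leaves the \<open>x\<close>-exponent and the component of a monomial
  alone. Monomials over finitely many places, i.e. values of this pair, behave like the monomials
  of a free \<open>K[t]\<close>-module of finite rank.
\<close>
definition place :: "vec_mon \<Rightarrow> expo \<times> nat" where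
  "place q = (snd (fst q), snd q)"

lemma place_tshift [simp]: "place (tshift \<delta> q) = place q"
  by (simp add: place_def tshift_def)

lemma nondecreasing_subsequence:
  fixes f :: "nat \<Rightarrow> nat"
  shows "\<exists>r::nat \<Rightarrow> nat. strict_mono r \<and> mono (f \<circ> r)"
proof -
  obtain r where r: "strict_mono r" "monoseq (f \<circ> r)"
    using seq_monosub[of f] by (auto simp: comp_def)
  show ?thesis
  proof (cases "mono (f \<circ> r)")
    case False
    with r(2) have dec: "antimono (f \<circ> r)" by (auto simp: monoseq_iff)
    obtain k where k: "\<And>j. (f \<circ> r) k \<le> (f \<circ> r) j"
      using ex_has_least_nat[of "\<lambda>_. True" _ "f \<circ> r"] by auto
    have "strict_mono (\<lambda>j. r (k + j))"
      using r(1) by (auto simp: strict_mono_def)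
    moreover have "(f \<circ> r) (k + j) = (f \<circ> r) k" for j
      using k[of "k + j"] antimonoD[OF dec, of k "k + j"] by simp
    then have "mono (f \<circ> (\<lambda>j. r (k + j)))"
      by (simp add: mono_def)
    ultimately show ?thesis by blast
  qed (use r(1) in blast)
qed

lemma common_nondecreasing_subsequence:
  fixes a :: "nat \<Rightarrow> 'b" and \<Phi> :: "('b \<Rightarrow> nat) set"
  assumes "finite \<Phi>"
  shows "\<exists>r::nat \<Rightarrow> nat. strict_mono r \<and> (\<forall>\<phi>\<in>\<Phi>. mono (\<lambda>j. \<phi> (a (r j))))"
  using assms
proof (induction \<Phi> rule: finite_induct)
  case empty
  show ?case by (auto intro!: exI[of _ "\<lambda>j. j"] simp: strict_mono_def)
next
  case (insert \<phi> \<Phi>)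
  from insert.IH obtain r :: "nat \<Rightarrow> nat"
    where r: "strict_mono r" "\<forall>\<psi>\<in>\<Phi>. mono (\<lambda>j. \<psi> (a (r j)))"
    by blast
  obtain r' :: "nat \<Rightarrow> nat" where r': "strict_mono r'" "mono ((\<lambda>j. \<phi> (a (r j))) \<circ> r')"
    using nondecreasing_subsequence[of "\<lambda>j. \<phi> (a (r j))"] by blast
  have "mono (\<lambda>j. \<psi> (a (r (r' j))))" if "\<psi> \<in> insert \<phi> \<Phi>" for \<psi>
  proof (cases "\<psi> = \<phi>")
    case False
    with that r(2) have "mono (\<lambda>j. \<psi> (a (r j)))" by blast
    with r'(1) show ?thesis by (simp add: mono_def strict_mono_less_eq)
  qed (use r'(2) in \<open>simp add: comp_def\<close>)
  moreover have "strict_mono (r \<circ> r')" using r(1) r'(1) by (rule strict_mono_o)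
  ultimately show ?case by (intro exI[of _ "r \<circ> r'"]) (simp add: comp_def)
qed

definition t_mons :: "nat \<Rightarrow> (expo \<times> nat) set \<Rightarrow> vec_mon set" where
  "t_mons m T = {q. Poly_Mapping.keys (fst (fst q)) \<subseteq> {..<m} \<and> place q \<in> T}"

text \<open>
  Some subsequence is nondecreasing in every exponent at once, so its first entry divides its
  second one as far as exponents are concerned. The places are treated as further coordinates.
\<close>
lemma dickson:
  fixes a :: "nat \<Rightarrow> vec_mon"
  assumes "finite T" and a: "\<And>j. a j \<in> t_mons m T"
  shows "\<exists>i j \<delta>. i < j \<and> Poly_Mapping.keys \<delta> \<subseteq> {..<m} \<and> a j = tshift \<delta> (a i)"
proof -
  \<comment> \<open>Nondecreasing indicators of all the places force the place to stay that of the first entry.\<close>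
  let ?\<Phi> = "(\<lambda>k q. Poly_Mapping.lookup (fst (fst q)) k) ` {..<m} \<union> (\<lambda>t q. of_bool (place q = t)) ` T"
  obtain r :: "nat \<Rightarrow> nat" where r: "strict_mono r" and mono: "\<And>\<phi>. \<phi> \<in> ?\<Phi> \<Longrightarrow> mono (\<lambda>j. \<phi> (a (r j)))"
    using common_nondecreasing_subsequence[of ?\<Phi> a] \<open>finite T\<close> by auto
  let ?p = "a (r 0)" and ?q = "a (r 1)"
  define \<delta> where "\<delta> = fst (fst ?q) - fst (fst ?p)"
  have le: "Poly_Mapping.lookup (fst (fst ?p)) k \<le> Poly_Mapping.lookup (fst (fst ?q)) k" for k
  proof (cases "k < m")
    case True
    then show ?thesis
      using monoD[OF mono[of "\<lambda>q. Poly_Mapping.lookup (fst (fst q)) k"], of 0 1] by auto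
  next
    case False
    with a[of "r 0"] have "k \<notin> Poly_Mapping.keys (fst (fst ?p))" by (auto simp: t_mons_def)
    then show ?thesis by (simp add: in_keys_iff)
  qed
  have "place ?q = place ?p"
    using monoD[OF mono[of "\<lambda>q. of_bool (place q = place ?p)"], of 0 1] a[of "r 0"]
    by (auto simp: t_mons_def of_bool_def split: if_splits)
  moreover have "fst (fst ?q) = \<delta> + fst (fst ?p)"
  proof (rule poly_mapping_eqI)
    fix k
    show "Poly_Mapping.lookup (fst (fst ?q)) k = Poly_Mapping.lookup (\<delta> + fst (fst ?p)) k"
      using le[of k] by (simp add: \<delta>_def lookup_add lookup_minus)
  qed
  ultimately have "?q = tshift \<delta> ?p"
    by (auto simp: tshift_def place_def prod_eq_iff)
  moreover have "Poly_Mapping.keys \<delta> \<subseteq> {..<m}"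
  proof
    fix k assume "k \<in> Poly_Mapping.keys \<delta>"
    then have "k \<in> Poly_Mapping.keys (fst (fst ?q))"
      by (auto simp: \<delta>_def lookup_minus in_keys_iff)
    with a[of "r 1"] show "k \<in> {..<m}" by (auto simp: t_mons_def)
  qed
  moreover have "r 0 < r 1" using r by (simp add: strict_mono_def)
  ultimately show ?thesis by blast
qed

text \<open>
  An infinite descending sequence would, by Dickson's lemma, contain a monomial and a later
  multiple of it by a power of \<open>t\<close>. This serves twice: for the lexicographic ordering, where
  multiples are larger, and for the reverse of a \<open>t\<close>-local ordering, where it yields leading
  monomials of power series vectors.
\<close>
lemma minimal_monomial_exists:
  assumes "finite T" "X \<subseteq> t_mons m T" "X \<noteq> {}" "transp_on X lt"
    and shift: "\<And>q \<delta>. q \<in> X \<Longrightarrow> Poly_Mapping.keys \<delta> \<subseteq> {..<m} \<Longrightarrow> tshift \<delta> q \<in> X \<Longrightarrow> \<not> lt (tshift \<delta> q) q"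
  shows "\<exists>p\<in>X. \<forall>q\<in>X. \<not> lt q p"
proof (rule ccontr)
  assume "\<not> ?thesis"
  then have "\<forall>p\<in>X. \<exists>q\<in>X. lt q p" by blast
  then obtain f where f: "\<And>p. p \<in> X \<Longrightarrow> f p \<in> X \<and> lt (f p) p" by metis
  obtain x where "x \<in> X" using assms(3) by blast
  define a where "a j = (f ^^ j) x" for j
  have X: "a j \<in> X" for j by (induction j) (auto simp: a_def \<open>x \<in> X\<close> f)
  have desc: "i < j \<Longrightarrow> lt (a j) (a i)" for i j
  proof (induction j)
    case (Suc j)
    have s: "lt (a (Suc j)) (a j)" using f[OF X[of j]] by (simp add: a_def)
    show ?case
    proof (cases "i = j")
      case False
      with Suc have "lt (a j) (a i)" by simp
      with s X show ?thesis using assms(4) by (meson transp_onD)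
    qed (use s in simp)
  qed simp
  have "a j \<in> t_mons m T" for j using X assms(2) by blast
  from dickson[OF assms(1), of a, OF this] obtain i j \<delta> where "i < j"
    "Poly_Mapping.keys \<delta> \<subseteq> {..<m}" "a j = tshift \<delta> (a i)" by blast
  with shift[of "a i" \<delta>] X[of i] X[of j] desc[of i j] show False by auto
qed

text \<open>
  The order used for monomials in this section is the lexicographic one on
  \<^typ>\<open>vec_mon\<close>, with exponent vectors themselves compared lexicographically.
\<close>
lemma expo_nonneg: "(0 :: expo) \<le> \<delta>"
proof -
  have "\<not> \<delta> < 0" by transfer (simp add: less_fun_def)
  then show ?thesis by simp
qed

lemma tshift_lex_mono: "q \<le> r \<Longrightarrow> tshift \<delta> q \<le> tshift \<delta> r"
  by (auto simp: tshift_def less_eq_prod_def less_prod_def add_strict_left_mono)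

lemma tshift_lex_ge: "q \<le> tshift \<delta> q"
proof -
  have "fst (fst q) \<le> \<delta> + fst (fst q)" using add_right_mono[OF expo_nonneg, of "fst (fst q)" \<delta>] by simp
  then show ?thesis by (auto simp: tshift_def less_eq_prod_def less_prod_def)
qed

text \<open>
  These are the free \<open>K[t]\<close>-modules of finite rank (for finite \<open>T\<close>) inside \<open>K[t,x]\<^sup>s\<close>. Since
  \<^term>\<open>K_tx m 0\<close> is the ring \<open>K[t]\<close>, being a \<open>K[t]\<close>-submodule is
  \<^term>\<open>is_submodule (K_tx m 0)\<close>.
\<close>
definition strip :: "nat \<Rightarrow> nat \<Rightarrow> nat \<Rightarrow> (expo \<times> nat) set \<Rightarrow> 'k::field ser_poly_vec set" where
  "strip m n s T = {v \<in> free_module (K_tx m n) s. place ` monomials v \<subseteq> T}"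

lemma strip_iff:
  "v \<in> strip m n s T \<longleftrightarrow>
    finite (monomials v) \<and> monomials v \<subseteq> vec_Mon m n s \<and> place ` monomials v \<subseteq> T"
  by (auto simp: strip_def free_module_K_iff)

lemma vec_Mon_t_mons: "q \<in> vec_Mon m n s \<Longrightarrow> place q \<in> T \<Longrightarrow> q \<in> t_mons m T"
  by (auto simp: vec_Mon_def Mon_def t_mons_def)

lemma strip_monomials: "v \<in> strip m n s T \<Longrightarrow> monomials v \<subseteq> t_mons m T"
  unfolding strip_iff by (blast intro: vec_Mon_t_mons)

lemma supp_K_t: "a \<in> K_tx m 0 \<Longrightarrow> p \<in> supp a \<Longrightarrow> Poly_Mapping.keys (fst p) \<subseteq> {..<m} \<and> snd p = 0"
  using subsetD[of "supp a" "Mon m 0" p] by (auto simp: K_tx_iff Mon_def)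

lemma monomials_smult_K_t:
  assumes "a \<in> K_tx m 0"
  shows "monomials (smult_vec a v) \<subseteq> {tshift \<delta> q | \<delta> q. Poly_Mapping.keys \<delta> \<subseteq> {..<m} \<and> q \<in> monomials v}"
proof
  fix r assume "r \<in> monomials (smult_vec a v)"
  with monomials_smult obtain p q where "r = (p + fst q, snd q)" "p \<in> supp a" "q \<in> monomials v"
    by blast
  moreover from this have "Poly_Mapping.keys (fst p) \<subseteq> {..<m}" "snd p = 0"
    using supp_K_t[OF assms] by auto
  ultimately have "r = tshift (fst p) q" by (simp add: tshift_def prod_eq_iff)
  with \<open>Poly_Mapping.keys (fst p) \<subseteq> {..<m}\<close> \<open>q \<in> monomials v\<close>
  show "r \<in> {tshift \<delta> q | \<delta> q. Poly_Mapping.keys \<delta> \<subseteq> {..<m} \<and> q \<in> monomials v}" by blast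
qed

lemma K_t_subset_K_tx: "K_tx m 0 \<subseteq> K_tx m n"
proof -
  have "Mon m 0 \<subseteq> Mon m n" by (auto simp: Mon_def)
  then show ?thesis unfolding subset_iff K_tx_iff by blast
qed

lemma is_submodule_strip: "is_submodule (K_tx m 0) (strip m n s T :: 'k::field ser_poly_vec set)"
  unfolding is_submodule_def
proof (intro conjI ballI)
  show "0 \<in> strip m n s T" by (simp add: strip_iff)
next
  fix u v :: "'k ser_poly_vec" assume uv: "u \<in> strip m n s T" "v \<in> strip m n s T"
  then have "u + v \<in> free_module (K_tx m n) s"
    unfolding strip_def by (intro submodule_add[OF is_submodule_free_module_K]) auto
  moreover have "place ` monomials (u + v) \<subseteq> T"
    using uv monomials_add[of u v] unfolding strip_iff by blast
  ultimately show "u + v \<in> strip m n s T" by (simp add: strip_def)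
next
  fix a :: "'k ser_poly" and v :: "'k ser_poly_vec"
  assume a: "a \<in> K_tx m 0" and v: "v \<in> strip m n s T"
  have "a \<in> K_tx m n" using a K_t_subset_K_tx by blast
  then have "smult_vec a v \<in> free_module (K_tx m n) s"
    using v unfolding strip_def by (intro submodule_smult[OF is_submodule_free_module_K]) auto
  moreover have "place ` monomials (smult_vec a v) \<subseteq> T"
  proof
    fix t assume "t \<in> place ` monomials (smult_vec a v)"
    with monomials_smult_K_t[OF a, of v] obtain \<delta> r where "t = place (tshift \<delta> r)" "r \<in> monomials v"
      by blast
    with v show "t \<in> T" by (auto simp: strip_iff)
  qed
  ultimately show "smult_vec a v \<in> strip m n s T" by (simp add: strip_def)
qed

lemma submodule_tmon:
  "is_submodule (K_tx m n) M \<Longrightarrow> v \<in> M \<Longrightarrow> Poly_Mapping.keys \<delta> \<subseteq> {..<m} \<Longrightarrow> smult_vec (tmon c \<delta>) v \<in> M"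
  using tmon_in_K_tx[of \<delta> m c n] by (simp add: is_submodule_def)

lemma submodule_diff:
  assumes "is_submodule (K_tx m n) M" "u \<in> M" "v \<in> M"
  shows "u - v \<in> M"
proof -
  have "u - v = u + smult_vec (tmon (- 1) 0) v"
    by (rule vcoeff_inject) simp
  also have "\<dots> \<in> M"
    using assms by (intro submodule_add submodule_tmon) auto
  finally show ?thesis .
qed

text \<open>
  If every step of the chain is proper, pick in each difference \<open>N\<^sub>k\<^sub>+\<^sub>1 - N\<^sub>k\<close> an element whose
  lexicographic leading monomial is minimal. By Dickson's lemma one of these leading monomials
  divides a later one, and cancelling the later one produces an element of the same difference
  with a smaller leading monomial.
\<close>
lemma ascending_chain_stabilizes:
  fixes N :: "nat \<Rightarrow> 'k::field ser_poly_vec set"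
  assumes "finite T" and N: "\<And>k. is_submodule (K_tx m 0) (N k)" "\<And>k. N k \<subseteq> strip m n s T"
    and asc: "\<And>k. N k \<subseteq> N (Suc k)"
  shows "\<exists>k. N (Suc k) = N k"
proof (rule ccontr)
  assume "\<not> ?thesis"
  with asc have new: "N (Suc k) - N k \<noteq> {}" for k by blast
  define lead :: "'k ser_poly_vec \<Rightarrow> vec_mon" where "lead v = Max (monomials v)" for v
  have lead: "lead v \<in> monomials v \<and> (\<forall>q\<in>monomials v. q \<le> lead v)"
    if "v \<in> strip m n s T" "v \<noteq> 0" for v
    using that Max_in[of "monomials v"] Max_ge[of "monomials v"] by (auto simp: lead_def strip_iff)
  have nz: "v \<in> strip m n s T \<and> v \<noteq> 0" if "v \<in> N (Suc k) - N k" for v k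
    using that N(2)[of "Suc k"] submodule_zero[OF N(1)[of k]] by auto
  have "\<exists>y\<in>N (Suc k) - N k. \<forall>z\<in>N (Suc k) - N k. \<not> lead z < lead y" for k
  proof -
    have "\<exists>p\<in>lead ` (N (Suc k) - N k). \<forall>q\<in>lead ` (N (Suc k) - N k). \<not> q < p"
    proof (rule minimal_monomial_exists[OF \<open>finite T\<close>])
      show "lead ` (N (Suc k) - N k) \<subseteq> t_mons m T"
        using lead nz strip_monomials by blast
    qed (use new tshift_lex_ge in \<open>auto simp: not_less\<close>)
    then show ?thesis by blast
  qed
  then obtain y where y: "\<And>k. y k \<in> N (Suc k) - N k"
    and min: "\<And>k z. z \<in> N (Suc k) - N k \<Longrightarrow> \<not> lead z < lead (y k)"
    by metis
  have "lead (y k) \<in> t_mons m T" for k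
    using lead nz[OF y[of k]] strip_monomials by blast
  from dickson[OF \<open>finite T\<close>, of "\<lambda>k. lead (y k)", OF this] obtain i j \<delta> where ij: "i < j"
    and \<delta>: "Poly_Mapping.keys \<delta> \<subseteq> {..<m}" and div: "lead (y j) = tshift \<delta> (lead (y i))" by blast
  define c where "c = vcoeff (y j) (lead (y j)) / vcoeff (y i) (lead (y i))"
  define w where "w = smult_vec (tmon c \<delta>) (y i)"
  have "N (Suc i) \<subseteq> N j" using lift_Suc_mono_le[of N "Suc i" j, OF asc] ij by simp
  then have w: "w \<in> N j"
    unfolding w_def using submodule_tmon[OF N(1)] y \<delta> by blast
  have z: "y j - w \<in> N (Suc j) - N j"
  proof -
    have "y j - w \<in> N (Suc j)" using submodule_diff[OF N(1)] y w asc by blast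
    moreover have "y j - w \<notin> N j"
      using submodule_add[OF N(1) _ w, of "y j - w"] y[of j] by auto
    ultimately show ?thesis by blast
  qed
  have "vcoeff (y i) (lead (y i)) \<noteq> 0"
    using lead nz[OF y[of i]] by (auto simp: monomials_iff)
  then have "vcoeff (y j - w) (lead (y j)) = 0"
    by (simp add: w_def c_def div vcoeff_tmon_shift)
  moreover have "q \<le> lead (y j)" if "q \<in> monomials (y j - w)" for q
  proof -
    from that monomials_diff monomials_tmon have "q \<in> monomials (y j) \<or> q \<in> tshift \<delta> ` monomials (y i)"
      unfolding w_def by blast
    then show ?thesis
    proof
      assume "q \<in> tshift \<delta> ` monomials (y i)"
      with lead nz[OF y[of i]] tshift_lex_mono show ?thesis unfolding div by blast
    qed (use lead nz[OF y[of j]] in blast)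
  qed
  moreover have "lead (y j - w) \<in> monomials (y j - w)" using lead nz[OF z] by blast
  ultimately have "lead (y j - w) < lead (y j)"
    by (metis monomials_iff order_le_less)
  with min[OF z] show False by blast
qed

section \<open>The intersection theorem over \<open>K[t]\<close>\<close>

definition tdeg :: "nat \<Rightarrow> expo \<Rightarrow> nat" where
  "tdeg m \<alpha> = (\<Sum>i<m. Poly_Mapping.lookup \<alpha> i)"

lemma tdeg_add: "tdeg m (\<alpha> + \<beta>) = tdeg m \<alpha> + tdeg m \<beta>"
  by (simp add: tdeg_def lookup_add sum.distrib)

definition order_ge :: "nat \<Rightarrow> nat \<Rightarrow> 'k::field ser_poly_vec set" where
  "order_ge m d = {v. \<forall>q\<in>monomials v. d \<le> tdeg m (fst (fst q))}"

lemma tmon_mult: "smult_vec (tmon c \<gamma>) (smult_vec (tmon d \<delta>) v) = smult_vec (tmon (c * d) (\<gamma> + \<delta>)) v"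
  (is "?l = ?r")
proof (rule vcoeff_inject)
  fix r
  show "vcoeff ?l r = vcoeff ?r r"
  proof (cases "r \<in> range (tshift (\<gamma> + \<delta>))")
    case True
    then obtain q where r: "r = tshift \<gamma> (tshift \<delta> q)" by (auto simp: tshift_tshift)
    have "vcoeff ?l r = c * d * vcoeff v q"
      unfolding r by (simp add: vcoeff_tmon_shift)
    moreover have "vcoeff ?r r = c * d * vcoeff v q"
      unfolding r tshift_tshift by (rule vcoeff_tmon_shift)
    ultimately show ?thesis by simp
  next
    case False
    have "monomials ?l \<subseteq> tshift \<gamma> ` tshift \<delta> ` monomials v"
      using monomials_tmon by (meson image_mono order_trans)
    then have "r \<notin> monomials ?l" using False by (auto simp: tshift_tshift)
    moreover have "r \<notin> monomials ?r" using False monomials_tmon by blast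
    ultimately show ?thesis by (simp add: monomials_iff)
  qed
qed

lemma submodule_chain_Union:
  assumes "C \<noteq> {}" "subset.chain \<A> C" "\<And>M. M \<in> \<A> \<Longrightarrow> is_submodule A M"
  shows "is_submodule A (\<Union>C)"
proof -
  have C: "M \<in> C \<Longrightarrow> is_submodule A M" for M using assms by (auto simp: subset.chain_def)
  have "u + v \<in> \<Union>C" if "u \<in> \<Union>C" "v \<in> \<Union>C" for u v
  proof -
    from that obtain M M' where M: "u \<in> M" "v \<in> M'" "M \<in> C" "M' \<in> C" by blast
    then have "M \<subseteq> M' \<or> M' \<subseteq> M" using assms(2) by (auto simp: subset_chain_def)
    with M submodule_add[OF C] show ?thesis by blast
  qed
  moreover have "smult_vec a v \<in> \<Union>C" if "a \<in> A" "v \<in> \<Union>C" for a v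
    using that C unfolding is_submodule_def by blast
  moreover have "0 \<in> \<Union>C" using assms(1) submodule_zero[OF C] by blast
  ultimately show ?thesis unfolding is_submodule_def by blast
qed

text \<open>
  Let \<open>F\<close> be the strip. Enlarge \<open>N\<^sub>0\<close> to a submodule \<open>N\<close> that is maximal among those not containing
  \<open>x\<close>; every properly larger submodule of \<open>F\<close> contains \<open>x\<close>. The submodules \<open>{y \<in> F. t\<^sub>i\<^sup>k y \<in> N}\<close>
  increase with \<open>k\<close>, hence two consecutive ones agree, for some \<open>k\<close>. If \<open>t\<^sub>i\<^sup>k F\<close> were not contained in
  \<open>N\<close>, then \<open>x = u + t\<^sub>i\<^sup>k z\<close> with \<open>u \<in> N\<close>; as \<open>t\<^sub>i x \<in> N\<close>, this gives \<open>t\<^sub>i\<^sup>k\<^sup>+\<^sup>1 z \<in> N\<close>, so \<open>t\<^sub>i\<^sup>k z \<in> N\<close> and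
  \<open>x \<in> N\<close>, a contradiction. So a power of each \<open>t\<^sub>i\<close> maps \<open>F\<close> into \<open>N\<close>, and \<open>N\<close> contains
  everything of large order in \<open>t\<close>. Then \<open>x \<in> N\<^sub>0 + t\<^sup>d F \<subseteq> N\<close> for large \<open>d\<close>, which is absurd.
\<close>
lemma strip_intersection_theorem:
  fixes x :: "'k::field ser_poly_vec"
  assumes "finite T" and sub: "is_submodule (K_tx m 0) N0" "N0 \<subseteq> strip m n s T"
    and x: "x \<in> strip m n s T"
    and tx: "\<And>i. i < m \<Longrightarrow> smult_vec (tmon 1 (Poly_Mapping.single i 1)) x \<in> N0"
    and approx: "\<And>d. \<exists>u\<in>N0. \<exists>w\<in>strip m n s T \<inter> order_ge m d. x = u + w"
  shows "x \<in> N0"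
proof (rule ccontr)
  assume "x \<notin> N0"
  let ?F = "strip m n s T :: 'k ser_poly_vec set"
  define \<A> where "\<A> = {M. is_submodule (K_tx m 0) M \<and> N0 \<subseteq> M \<and> M \<subseteq> ?F \<and> x \<notin> M}"
  have "\<exists>M\<in>\<A>. \<forall>X\<in>\<A>. M \<subseteq> X \<longrightarrow> X = M"
  proof (rule subset_Zorn_nonempty)
    show "\<A> \<noteq> {}" using sub \<open>x \<notin> N0\<close> by (auto simp: \<A>_def)
    fix C assume C: "C \<noteq> {}" "subset.chain \<A> C"
    have "is_submodule (K_tx m 0) (\<Union>C)"
      using C by (rule submodule_chain_Union) (simp add: \<A>_def)
    moreover have "C \<subseteq> \<A>" using C(2) by (simp add: subset_chain_def)
    ultimately show "\<Union>C \<in> \<A>" using C(1) unfolding \<A>_def by blast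
  qed
  then obtain N where "N \<in> \<A>" and max: "\<And>M. M \<in> \<A> \<Longrightarrow> N \<subseteq> M \<Longrightarrow> M = N" by blast
  then have N: "is_submodule (K_tx m 0) N" "N0 \<subseteq> N" "N \<subseteq> ?F" "x \<notin> N" by (auto simp: \<A>_def)
  have "\<exists>k. \<forall>y\<in>?F. smult_vec (tmon 1 (Poly_Mapping.single i k)) y \<in> N" if i: "i < m" for i
  proof -
    define t where "t k = smult_vec (tmon (1::'k) (Poly_Mapping.single i k))" for k
    have t_add: "t k (u + v) = t k u + t k v" for k u v
      by (simp add: t_def smult_vec_add_right)
    have t_smult: "t k (smult_vec a v) = smult_vec a (t k v)" for k a v
      by (simp add: t_def smult_vec_assoc mult.commute)
    have t_Suc: "t (Suc 0) (t k v) = t (Suc k) v" for k v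
      by (simp add: t_def tmon_mult flip: single_add)
    have t_in: "t k v \<in> M" if "is_submodule (K_tx m 0) M" "v \<in> M" for k v M
      unfolding t_def using that i by (intro submodule_tmon) auto
    define Ker where "Ker k = {y \<in> ?F. t k y \<in> N}" for k
    have "is_submodule (K_tx m 0) (Ker k)" for k
      using is_submodule_strip[of m n s T] N(1) unfolding is_submodule_def Ker_def
      by (auto simp: t_add t_smult) (simp add: t_def)
    moreover have "Ker k \<subseteq> Ker (Suc k)" for k
    proof
      fix y assume "y \<in> Ker k"
      then show "y \<in> Ker (Suc k)"
        using t_in[OF N(1), of "t k y" "Suc 0"] by (simp add: Ker_def t_Suc)
    qed
    ultimately obtain k where k: "Ker (Suc k) = Ker k"
      using ascending_chain_stabilizes[of T m Ker n s] \<open>finite T\<close> by (auto simp: Ker_def)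
    have "t k y \<in> N" if "y \<in> ?F" for y
    proof (rule ccontr)
      assume ty: "t k y \<notin> N"
      define M where "M = {u + t k z | u z. u \<in> N \<and> z \<in> ?F}"
      have MI: "u + t k z \<in> M" if "u \<in> N" "z \<in> ?F" for u z
        unfolding M_def using that by blast
      have F0: "0 \<in> ?F" and t0: "t k 0 = 0"
        using submodule_zero[OF is_submodule_strip] by (auto simp: t_def)
      have "N \<subseteq> M" using MI[OF _ F0] by (auto simp: t0)
      have "is_submodule (K_tx m 0) M"
        unfolding is_submodule_def
      proof (intro conjI ballI)
        show "0 \<in> M" using submodule_zero[OF N(1)] \<open>N \<subseteq> M\<close> by blast
      next
        fix v v' assume "v \<in> M" "v' \<in> M"
        then obtain u z u' z' where "u \<in> N" "z \<in> ?F" "u' \<in> N" "z' \<in> ?F"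
          and vv: "v = u + t k z" "v' = u' + t k z'" unfolding M_def by blast
        then have "(u + u') + t k (z + z') \<in> M"
          by (intro MI submodule_add[OF N(1)] submodule_add[OF is_submodule_strip])
        then show "v + v' \<in> M" unfolding vv t_add by (simp add: algebra_simps)
      next
        fix a :: "'k ser_poly" and v assume a: "a \<in> K_tx m 0" and "v \<in> M"
        then obtain u z where "u \<in> N" "z \<in> ?F" and v: "v = u + t k z" unfolding M_def by blast
        then have "smult_vec a u + t k (smult_vec a z) \<in> M"
          using a N(1) is_submodule_strip[of m n s T] by (intro MI) (auto simp: is_submodule_def)
        then show "smult_vec a v \<in> M" unfolding v t_smult smult_vec_add_right .
      qed
      moreover have "M \<subseteq> ?F"
        unfolding M_def using N(3) submodule_add[OF is_submodule_strip] t_in[OF is_submodule_strip] by blast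
      moreover have "t k y \<in> M" using MI[OF submodule_zero[OF N(1)] that] by simp
      ultimately have "x \<in> M" using max[of M] \<open>N \<subseteq> M\<close> N(2) ty by (auto simp: \<A>_def)
      then obtain u z where u: "u \<in> N" and z: "z \<in> ?F" and xuz: "x = u + t k z" unfolding M_def by blast
      have "t (Suc 0) x \<in> N" using tx[OF i] N(2) by (auto simp: t_def)
      moreover have "t (Suc 0) u \<in> N" using t_in[OF N(1) u] .
      ultimately have "t (Suc 0) x - t (Suc 0) u \<in> N" by (rule submodule_diff[OF N(1)])
      then have "t (Suc k) z \<in> N" by (simp add: xuz t_add t_Suc)
      with z k have "t k z \<in> N" by (auto simp: Ker_def set_eq_iff)
      with u N(1) have "x \<in> N" unfolding xuz by (intro submodule_add)
      with N(4) show False ..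
    qed
    then show ?thesis by (auto simp: t_def)
  qed
  then obtain k where k: "\<And>i y. i < m \<Longrightarrow> y \<in> ?F \<Longrightarrow> smult_vec (tmon 1 (Poly_Mapping.single i (k i))) y \<in> N"
    by metis
  \<comment> \<open>By the pigeonhole principle, degree \<open>d\<close> forces some \<open>t\<^sub>i\<close>-exponent to be at least \<open>k i\<close>. The
    successor matters if \<open>m = 0\<close>: then no monomial may have degree \<open>d\<close>.\<close>
  define d where "d = Suc (\<Sum>i<m. k i)"
  obtain u w where u: "u \<in> N0" and w: "w \<in> ?F" "w \<in> order_ge m d" and xuw: "x = u + w"
    using approx[of d] by blast
  have "w \<in> N"
  proof (rule monomial_terms_in_imp_in)
    show "finite (monomials w)" using w by (simp add: strip_iff)
    show "0 \<in> N" "\<And>u v. u \<in> N \<Longrightarrow> v \<in> N \<Longrightarrow> u + v \<in> N"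
      using N(1) by (simp_all add: is_submodule_def)
    fix q assume q: "q \<in> monomials w"
    let ?\<alpha> = "fst (fst q)"
    have "\<exists>i<m. k i \<le> Poly_Mapping.lookup ?\<alpha> i"
    proof (rule ccontr)
      assume "\<not> ?thesis"
      then have "tdeg m ?\<alpha> \<le> (\<Sum>i<m. k i)" unfolding tdeg_def by (intro sum_mono) auto
      moreover have "d \<le> tdeg m ?\<alpha>" using w(2) q by (simp add: order_ge_def)
      ultimately show False by (simp add: d_def)
    qed
    then obtain i where i: "i < m" "k i \<le> Poly_Mapping.lookup ?\<alpha> i" by blast
    let ?t = "Poly_Mapping.single i (k i)"
    define q' where "q' = ((?\<alpha> - ?t, snd (fst q)), snd q)"
    have "?t + (?\<alpha> - ?t) = ?\<alpha>"
      by (rule poly_mapping_eqI) (use i in \<open>auto simp: lookup_add lookup_minus lookup_single when_def\<close>)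
    then have qq': "q = tshift ?t q'" by (simp add: q'_def tshift_def)
    have qM: "q \<in> vec_Mon m n s" "place q \<in> T" using w(1) q by (auto simp: strip_iff)
    have "Poly_Mapping.keys (?\<alpha> - ?t) \<subseteq> Poly_Mapping.keys ?\<alpha>"
      by (auto simp: in_keys_iff lookup_minus)
    also have "\<dots> \<subseteq> {..<m}" using qM(1) by (auto simp: vec_Mon_def Mon_def)
    finally have "q' \<in> vec_Mon m n s" "place q' \<in> T"
      using qM by (auto simp: q'_def vec_Mon_def Mon_def place_def)
    then have "monomial_vec q' \<in> ?F" by (simp add: strip_iff)
    from k[OF i(1) this] have "smult_vec (tmon (vcoeff w q) 0) (smult_vec (tmon 1 ?t) (monomial_vec q')) \<in> N"
      by (rule submodule_tmon[OF N(1)]) simp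
    then have "smult_vec (tmon (vcoeff w q) ?t) (monomial_vec q') \<in> N"
      by (simp add: tmon_mult)
    then show "smult_vec (tmon (vcoeff w q) 0) (monomial_vec q) \<in> N"
      unfolding qq' by (simp only: tmon_monomial_vec[of _ ?t])
  qed
  with u N(2) have "x \<in> N" unfolding xuw by (intro submodule_add[OF N(1)]) auto
  with N(4) show False ..
qed

section \<open>Leading monomials for \<open>t\<close>-local orderings\<close>

lemma vec_monomial_orderingD:
  assumes "vec_monomial_ordering m n s gt"
  shows "irreflp_on (vec_Mon m n s) gt" "transp_on (vec_Mon m n s) gt" "totalp_on (vec_Mon m n s) gt"
  using assms by (simp_all add: vec_monomial_ordering_def strict_total_order_on_def)

lemma zero_in_Mon [simp]: "0 \<in> Mon m n"
  by (simp add: Mon_def zero_prod_def)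

lemma tshift_vec_Mon:
  "q \<in> vec_Mon m n s \<Longrightarrow> Poly_Mapping.keys \<delta> \<subseteq> {..<m} \<Longrightarrow> tshift \<delta> q \<in> vec_Mon m n s"
  using Mon_add[of "(\<delta>, 0)" m n "fst q"]
  by (auto simp: tshift_def vec_Mon_def Mon_def)

lemma gt_tshift_single:
  assumes "vec_monomial_ordering m n s gt" "t_local m n s gt" "q \<in> vec_Mon m n s" "i < m"
  shows "gt q (tshift (Poly_Mapping.single i 1) q)"
proof -
  let ?t = "(Poly_Mapping.single i 1, 0) :: mon"
  obtain p j where q: "q = (p, j)" by (cases q)
  with assms(3) have p: "p \<in> Mon m n" "j < s" by (auto simp: vec_Mon_def)
  have t: "?t \<in> Mon m n" using assms(4) by (simp add: Mon_def)
  obtain gt0 where gt0: "induced_ordering m n s gt gt0" "gt0 0 ?t"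
    using assms(2,4) by (auto simp: t_local_def)
  then have "gt (0, j) (?t, j)"
    using p(2) t zero_in_Mon unfolding induced_ordering_def by blast
  moreover have "(0, j) \<in> vec_Mon m n s" "(?t, j) \<in> vec_Mon m n s"
    using p(2) t by (auto simp: vec_Mon_def)
  moreover have "\<forall>(p, i)\<in>vec_Mon m n s. \<forall>(p', j)\<in>vec_Mon m n s. \<forall>q\<in>Mon m n.
        gt (p, i) (p', j) \<longrightarrow> gt (q + p, i) (q + p', j)"
    using assms(1) unfolding vec_monomial_ordering_def by blast
  ultimately have "gt (p + 0, j) (p + ?t, j)" using p(1) by blast
  then show ?thesis by (simp add: q tshift_def plus_prod_def add.commute)
qed

text \<open>
  Removing one variable at a time reduces to the single step above. Through this lemma and that
  step \<open>t\<close>-locality enters the proof.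
\<close>
lemma gt_tshift:
  assumes "vec_monomial_ordering m n s gt" "t_local m n s gt" "q \<in> vec_Mon m n s"
    and "Poly_Mapping.keys \<delta> \<subseteq> {..<m}" "\<delta> \<noteq> 0"
  shows "gt q (tshift \<delta> q)"
  using assms(4,5)
proof (induction "tdeg m \<delta>" arbitrary: \<delta> rule: less_induct)
  case less
  from less.prems obtain i where i: "i < m" "i \<in> Poly_Mapping.keys \<delta>"
    by (metis keys_eq_empty lessThan_iff subset_iff ex_in_conv)
  let ?t = "Poly_Mapping.single i (1::nat)"
  define \<gamma> where "\<gamma> = \<delta> - ?t"
  have \<delta>: "\<delta> = ?t + \<gamma>"
    by (rule poly_mapping_eqI)
      (use i in \<open>auto simp: \<gamma>_def lookup_add lookup_minus lookup_single when_def in_keys_iff\<close>)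
  have \<gamma>: "Poly_Mapping.keys \<gamma> \<subseteq> {..<m}"
  proof -
    have "Poly_Mapping.keys \<gamma> \<subseteq> Poly_Mapping.keys \<delta>"
      by (auto simp: \<gamma>_def in_keys_iff lookup_minus)
    with less.prems show ?thesis by blast
  qed
  show ?case
  proof (cases "\<gamma> = 0")
    case True
    then show ?thesis using gt_tshift_single[OF assms(1-3) i(1)] by (simp add: \<delta>)
  next
    case False
    have "tdeg m ?t = (\<Sum>k<m. if k = i then 1 else 0)"
      unfolding tdeg_def by (rule sum.cong) (auto simp: lookup_single when_def)
    then have "tdeg m \<gamma> < tdeg m \<delta>" using i(1) by (simp add: \<delta> tdeg_add)
    then have "gt q (tshift \<gamma> q)" using less.hyps \<gamma> False by blast
    moreover have "gt (tshift \<gamma> q) (tshift ?t (tshift \<gamma> q))"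
      by (rule gt_tshift_single[OF assms(1,2) tshift_vec_Mon[OF assms(3) \<gamma>] i(1)])
    then have "gt (tshift \<gamma> q) (tshift \<delta> q)" by (simp add: tshift_tshift \<delta>)
    ultimately show ?thesis
      using vec_monomial_orderingD(2)[OF assms(1)] assms(3) tshift_vec_Mon[OF assms(3)] \<gamma> less.prems(1) by (meson transp_onD)
  qed
qed

definition is_lead :: "(vec_mon \<Rightarrow> vec_mon \<Rightarrow> bool) \<Rightarrow> 'k::field ser_poly_vec \<Rightarrow> vec_mon \<Rightarrow> bool" where
  "is_lead gt f p \<longleftrightarrow> p \<in> monomials f \<and> (\<forall>q\<in>monomials f. q \<noteq> p \<longrightarrow> gt p q)"

lemma lm_eq_monomial_vec:
  assumes "vec_monomial_ordering m n s gt" "monomials f \<subseteq> vec_Mon m n s" "is_lead gt f p"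
  shows "lm gt f = monomial_vec p"
proof -
  note ord = vec_monomial_orderingD[OF assms(1)]
  have "(THE p. p \<in> monomials f \<and> (\<forall>q\<in>monomials f. q \<noteq> p \<longrightarrow> gt p q)) = p"
  proof (rule the_equality)
    fix p' assume p': "p' \<in> monomials f \<and> (\<forall>q\<in>monomials f. q \<noteq> p' \<longrightarrow> gt p' q)"
    show "p' = p"
    proof (rule ccontr)
      assume "p' \<noteq> p"
      with p' assms(3) have "gt p p'" "gt p' p" "p \<in> vec_Mon m n s" "p' \<in> vec_Mon m n s"
        using assms(2) by (auto simp: is_lead_def)
      with ord show False by (meson transp_onD irreflp_onD)
    qed
  qed (use assms(3) in \<open>simp add: is_lead_def\<close>)
  moreover have "f \<noteq> 0" using assms(3) by (auto simp: is_lead_def)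
  ultimately show ?thesis by (simp add: lm_def)
qed

lemma finite_places: "finite (place ` monomials v)"
proof (rule finite_subset)
  show "place ` monomials v \<subseteq> (\<Union>i\<in>Poly_Mapping.keys v.
      (\<lambda>\<beta>. (\<beta>, i)) ` Poly_Mapping.keys (Poly_Mapping.lookup v i))"
  proof
    fix t assume "t \<in> place ` monomials v"
    then obtain q where q: "q \<in> monomials v" "t = place q" by blast
    then have "snd (fst q) \<in> Poly_Mapping.keys (Poly_Mapping.lookup v (snd q))"
      by (auto simp: monomials_iff vcoeff_def in_keys_iff)
    moreover from this have "snd q \<in> Poly_Mapping.keys v"
      by (auto simp: in_keys_iff)
    ultimately show "t \<in> (\<Union>i\<in>Poly_Mapping.keys v.
      (\<lambda>\<beta>. (\<beta>, i)) ` Poly_Mapping.keys (Poly_Mapping.lookup v i))"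
      unfolding q(2) place_def by blast
  qed
qed simp

lemma lead_exists:
  assumes "vec_monomial_ordering m n s gt" "t_local m n s gt"
    and f: "f \<noteq> 0" "monomials f \<subseteq> vec_Mon m n s"
  shows "\<exists>p. is_lead gt f p"
proof -
  note ord = vec_monomial_orderingD[OF assms(1)]
  have "\<exists>p\<in>monomials f. \<forall>q\<in>monomials f. \<not> gt q p"
  proof (rule minimal_monomial_exists[OF finite_places[of f]])
    show "monomials f \<subseteq> t_mons m (place ` monomials f)"
      using f(2) by (blast intro: vec_Mon_t_mons)
    show "monomials f \<noteq> {}" using f(1) by simp
    show "transp_on (monomials f) gt" using ord(2) f(2) by (rule transp_on_subset)
    fix q \<delta> assume "q \<in> monomials f" "Poly_Mapping.keys \<delta> \<subseteq> {..<m}" "tshift \<delta> q \<in> monomials f"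
    then have "q \<in> vec_Mon m n s" "tshift \<delta> q \<in> vec_Mon m n s" and \<delta>: "Poly_Mapping.keys \<delta> \<subseteq> {..<m}"
      using f(2) by auto
    with ord gt_tshift[OF assms(1,2)] show "\<not> gt (tshift \<delta> q) q"
      by (metis irreflp_onD transp_onD tshift_0)
  qed
  then obtain p where p: "p \<in> monomials f" "\<forall>q\<in>monomials f. \<not> gt q p" by blast
  then have "gt p q" if "q \<in> monomials f" "q \<noteq> p" for q
    using that f(2) totalp_onD[OF ord(3), of p q] by blast
  with p(1) show ?thesis unfolding is_lead_def by blast
qed

section \<open>Approximation by truncated power series\<close>

lemma order_ge_add: "u \<in> order_ge m d \<Longrightarrow> v \<in> order_ge m d \<Longrightarrow> u + v \<in> order_ge m d"
  using monomials_add[of u v] unfolding order_ge_def by blast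

lemma order_ge_smult:
  assumes "(\<forall>p\<in>supp a. d \<le> tdeg m (fst p)) \<or> v \<in> order_ge m d"
  shows "smult_vec a v \<in> order_ge m d"
proof -
  have "d \<le> tdeg m (fst (fst r))" if r: "r \<in> monomials (smult_vec a v)" for r
  proof -
    obtain p q where "r = (p + fst q, snd q)" "p \<in> supp a" "q \<in> monomials v"
      using r monomials_smult by blast
    then show ?thesis
      using assms by (force simp: tdeg_add order_ge_def intro: trans_le_add1 trans_le_add2)
  qed
  then show ?thesis by (simp add: order_ge_def)
qed

lemma finite_tdeg_less: "finite {\<alpha>. Poly_Mapping.keys \<alpha> \<subseteq> {..<m} \<and> tdeg m \<alpha> < d}" (is "finite ?A")
proof -
  let ?F = "{f :: nat \<Rightarrow> nat. \<forall>i. (i \<in> {..<m} \<longrightarrow> f i \<in> {..<d}) \<and> (i \<notin> {..<m} \<longrightarrow> f i = 0)}"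
  have "Poly_Mapping.lookup \<alpha> \<in> ?F" if "\<alpha> \<in> ?A" for \<alpha>
  proof -
    have "Poly_Mapping.lookup \<alpha> i < d" if "i < m" for i
    proof -
      have "Poly_Mapping.lookup \<alpha> i \<le> tdeg m \<alpha>"
        unfolding tdeg_def using that by (intro member_le_sum) auto
      with \<open>\<alpha> \<in> ?A\<close> show ?thesis by simp
    qed
    moreover have "Poly_Mapping.lookup \<alpha> i = 0" if "\<not> i < m" for i
    proof -
      have "i \<notin> Poly_Mapping.keys \<alpha>" using that \<open>\<alpha> \<in> ?A\<close> by auto
      then show ?thesis by (simp add: in_keys_iff)
    qed
    ultimately show ?thesis by simp
  qed
  then have "Poly_Mapping.lookup ` ?A \<subseteq> ?F" by (rule image_subsetI)
  moreover have "finite ?F" by (rule finite_set_of_finite_funs) auto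
  ultimately have "finite (Poly_Mapping.lookup ` ?A)" by (rule finite_subset)
  moreover have "inj_on Poly_Mapping.lookup ?A" by (rule inj_onI) (simp only: poly_mapping.lookup_inject)
  ultimately show ?thesis by (rule finite_imageD)
qed

definition t_truncate :: "nat \<Rightarrow> nat \<Rightarrow> 'k::field ser_poly \<Rightarrow> 'k ser_poly" where
  "t_truncate m d a = Poly_Mapping.map
     (\<lambda>c. Abs_mfps (\<lambda>\<alpha>. if tdeg m \<alpha> < d then mfps_nth c \<alpha> else 0)) a"

lemma nth_lookup_t_truncate:
  "mfps_nth (Poly_Mapping.lookup (t_truncate m d a) \<beta>) \<alpha> =
    (if tdeg m \<alpha> < d then mfps_nth (Poly_Mapping.lookup a \<beta>) \<alpha> else 0)"
  by (simp add: t_truncate_def Poly_Mapping.map.rep_eq when_def)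

lemma t_truncate_in_K_tx:
  assumes "a \<in> R_x m n" shows "t_truncate m d a \<in> K_tx m n"
proof -
  have supp: "supp (t_truncate m d a) = {p \<in> supp a. tdeg m (fst p) < d}"
    by (auto simp: supp_def nth_lookup_t_truncate)
  have sub: "supp a \<subseteq> Mon m n" using assms by (simp add: R_x_iff)
  have "p \<in> {\<alpha>. Poly_Mapping.keys \<alpha> \<subseteq> {..<m} \<and> tdeg m \<alpha> < d} \<times> Poly_Mapping.keys a"
    if "p \<in> supp (t_truncate m d a)" for p
  proof -
    have p: "p \<in> supp a" using that supp by blast
    then have "snd p \<in> Poly_Mapping.keys a" by (auto simp: supp_def in_keys_iff)
    moreover have "p \<in> Mon m n" using p sub by blast
    ultimately show ?thesis using that supp by (cases p) (auto simp: Mon_def)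
  qed
  then have "finite (supp (t_truncate m d a))"
    by (intro finite_subset[OF _ finite_cartesian_product[OF finite_tdeg_less finite_keys]]) blast
  with supp sub show ?thesis by (auto simp: K_tx_iff)
qed

lemma supp_minus_t_truncate: "p \<in> supp (a - t_truncate m d a) \<Longrightarrow> d \<le> tdeg m (fst p)"
  by (auto simp: supp_def lookup_minus nth_lookup_t_truncate split: if_splits)

lemma place_smult:
  assumes "q \<in> monomials (smult_vec a v)"
  shows "place q \<in> (\<lambda>(\<beta>, t). (\<beta> + fst t, snd t)) ` (Poly_Mapping.keys a \<times> place ` monomials v)"
proof -
  obtain p r where q: "q = (p + fst r, snd r)" "p \<in> supp a" "r \<in> monomials v"
    using assms monomials_smult by blast
  then have "snd p \<in> Poly_Mapping.keys a" by (auto simp: supp_def in_keys_iff)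
  with q(3) have "(snd p, place r) \<in> Poly_Mapping.keys a \<times> place ` monomials v" by blast
  then show ?thesis by (rule rev_image_eqI) (simp add: q(1) place_def)
qed

text \<open>
  The elements \<open>f\<close> that can be approximated in this way form an \<open>R[x]\<close>-submodule containing \<open>G\<close>. For
  scalar multiples, if \<open>b\<close> is the truncation of \<open>a\<close> and \<open>h\<close> approximates \<open>v\<close>, then
  \<open>a v - b h = (a - b) v + b (v - h)\<close> has large order. A single finite set \<open>T\<close> works for all orders
  \<open>d\<close> because a polynomial in \<open>x\<close> over \<open>R\<close> involves only finitely many powers of \<open>x\<close>.
\<close>
lemma t_adic_approximation:
  fixes G :: "'k::field ser_poly_vec set"
  assumes G: "G \<subseteq> free_module (K_tx m n) s" and f: "f \<in> generated_submodule (R_x m n) G"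
  shows "\<exists>T. finite T \<and> (\<forall>d. \<exists>h \<in> generated_submodule (K_tx m n) G.
    place ` monomials h \<subseteq> T \<and> f - h \<in> order_ge m d)"
proof -
  let ?I = "generated_submodule (K_tx m n) G"
  note I = is_submodule_generated[of "K_tx m n" G]
  define app where "app f T \<longleftrightarrow> finite T \<and> (\<forall>d. \<exists>h\<in>?I. place ` monomials h \<subseteq> T \<and> f - h \<in> order_ge m d)"
    for f :: "'k ser_poly_vec" and T
  have appI: "app g (place ` monomials g)" if "g \<in> ?I" for g
    unfolding app_def using that finite_places by (auto simp: order_ge_def intro!: bexI[of _ g])
  have "is_submodule (R_x m n) {f. \<exists>T. app f T}"
    unfolding is_submodule_def
  proof (intro conjI ballI)
    show "0 \<in> {f. \<exists>T. app f T}" using appI submodule_zero[OF I] by blast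
  next
    fix u v assume "u \<in> {f. \<exists>T. app f T}" "v \<in> {f. \<exists>T. app f T}"
    then obtain T T' where T: "app u T" "app v T'" by blast
    have "app (u + v) (T \<union> T')"
      unfolding app_def
    proof (intro conjI allI)
      show "finite (T \<union> T')" using T by (simp add: app_def)
      fix d
      obtain h h' where h: "h \<in> ?I" "place ` monomials h \<subseteq> T" "u - h \<in> order_ge m d"
        and h': "h' \<in> ?I" "place ` monomials h' \<subseteq> T'" "v - h' \<in> order_ge m d"
        using T unfolding app_def by blast
      have "(u + v) - (h + h') \<in> order_ge m d"
        using order_ge_add[OF h(3) h'(3)] by (simp add: algebra_simps)
      moreover have "place ` monomials (h + h') \<subseteq> T \<union> T'"
        using h(2) h'(2) monomials_add[of h h'] by blast
      ultimately show "\<exists>h\<in>?I. place ` monomials h \<subseteq> T \<union> T' \<and> u + v - h \<in> order_ge m d"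
        using submodule_add[OF I h(1) h'(1)] by blast
    qed
    then show "u + v \<in> {f. \<exists>T. app f T}" by blast
  next
    fix a :: "'k ser_poly" and v assume a: "a \<in> R_x m n" and "v \<in> {f. \<exists>T. app f T}"
    then obtain T where T: "app v T" by blast
    let ?T' = "(\<lambda>(\<beta>, t). (\<beta> + fst t, snd t)) ` (Poly_Mapping.keys a \<times> T)"
    have "app (smult_vec a v) ?T'"
      unfolding app_def
    proof (intro conjI allI)
      show "finite ?T'" using T by (simp add: app_def)
      fix d
      obtain h where h: "h \<in> ?I" "place ` monomials h \<subseteq> T" "v - h \<in> order_ge m d"
        using T unfolding app_def by blast
      let ?b = "t_truncate m d a"
      have b: "?b \<in> K_tx m n" using a by (rule t_truncate_in_K_tx)
      have "Poly_Mapping.keys ?b \<subseteq> Poly_Mapping.keys a"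
      proof
        fix \<beta> assume "\<beta> \<in> Poly_Mapping.keys ?b"
        then show "\<beta> \<in> Poly_Mapping.keys a"
          by (auto simp: in_keys_iff mfps_eq_0_iff nth_lookup_t_truncate split: if_splits)
      qed
      then have "(\<lambda>(\<beta>, t). (\<beta> + fst t, snd t)) ` (Poly_Mapping.keys ?b \<times> place ` monomials h) \<subseteq> ?T'"
        using h(2) by (intro image_mono Sigma_mono)
      then have "place ` monomials (smult_vec ?b h) \<subseteq> ?T'"
        using place_smult[of _ ?b h] by blast
      moreover have "smult_vec a v - smult_vec ?b h \<in> order_ge m d"
      proof -
        have "smult_vec (a - ?b) v \<in> order_ge m d"
          using supp_minus_t_truncate by (intro order_ge_smult) blast
        moreover have "smult_vec ?b (v - h) \<in> order_ge m d"
          using h(3) by (intro order_ge_smult) blast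
        ultimately have "smult_vec (a - ?b) v + smult_vec ?b (v - h) \<in> order_ge m d"
          by (rule order_ge_add)
        then show ?thesis by (simp add: smult_vec_diff_left smult_vec_diff_right)
      qed
      moreover have "smult_vec ?b h \<in> ?I" using I b h(1) by (simp add: is_submodule_def)
      ultimately show "\<exists>h\<in>?I. place ` monomials h \<subseteq> ?T' \<and> smult_vec a v - h \<in> order_ge m d"
        by blast
    qed
    then show "smult_vec a v \<in> {f. \<exists>T. app f T}" by blast
  qed
  moreover have "G \<subseteq> {f. \<exists>T. app f T}"
    using appI generated_submodule_superset by blast
  ultimately have "f \<in> {f. \<exists>T. app f T}"
    using generated_submodule_minimal f by blast
  then show ?thesis by (simp add: app_def)
qed

section \<open>Equality of the leading submodules\<close>

lemma monomials_generated_submodule_R: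
  assumes "G \<subseteq> free_module (K_tx m n) s" "f \<in> generated_submodule (R_x m n) G"
  shows "monomials f \<subseteq> vec_Mon m n s"
proof -
  have "G \<subseteq> free_module (R_x m n) s"
    using assms(1) by (auto simp: free_module_K_iff monomials_free_module_R)
  then have "f \<in> free_module (R_x m n) s"
    using assms(2) generated_submodule_minimal is_submodule_free_module_R by blast
  then show ?thesis by (simp add: monomials_free_module_R)
qed

text \<open>
  The intersection theorem is applied to the monomial \<open>p\<close> and the submodule \<open>N = (I \<inter> F) + V\<close>, where
  \<open>F\<close> is a strip containing \<open>p\<close> and all the approximations \<open>h\<close> of \<open>f\<close>, and \<open>V\<close> consists of the
  vectors in \<open>F\<close> with all monomials below \<open>p\<close>. For \<open>c\<close> the coefficient of \<open>f\<close> at \<open>p\<close>, every term of \<open>h - c p\<close>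
  either has large order or is a term of \<open>f\<close> other than its leading one, and so lies in \<open>V\<close>.
\<close>
lemma lead_in_polynomial_submodule:
  fixes G :: "'k::field ser_poly_vec set"
  assumes ord: "vec_monomial_ordering m n s gt" and loc: "t_local m n s gt"
    and G: "G \<subseteq> free_module (K_tx m n) s"
    and f: "f \<in> generated_submodule (R_x m n) G" and p: "is_lead gt f p"
  shows "\<exists>h\<in>generated_submodule (K_tx m n) G. is_lead gt h p"
proof -
  let ?I = "generated_submodule (K_tx m n) G"
  note I = is_submodule_generated[of "K_tx m n" G]
  have I_poly: "h \<in> free_module (K_tx m n) s" if "h \<in> ?I" for h
    using generated_submodule_minimal[OF G is_submodule_free_module_K] that by blast
  have fM: "monomials f \<subseteq> vec_Mon m n s" by (rule monomials_generated_submodule_R[OF G f])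
  note trans = vec_monomial_orderingD(2)[OF ord]
  have pf: "p \<in> monomials f" and plead: "\<And>q. q \<in> monomials f \<Longrightarrow> q \<noteq> p \<Longrightarrow> gt p q"
    using p by (auto simp: is_lead_def)
  have pM: "p \<in> vec_Mon m n s" using pf fM by blast
  obtain T0 where T0: "finite T0"
    "\<And>d. \<exists>h\<in>?I. place ` monomials h \<subseteq> T0 \<and> f - h \<in> order_ge m d"
    using t_adic_approximation[OF G f] by blast
  define T where "T = insert (place p) T0"
  let ?F = "strip m n s T :: 'k ser_poly_vec set"
  define V where "V = {v \<in> ?F. \<forall>q\<in>monomials v. gt p q}"
  define N where "N = {h + v | h v. h \<in> ?I \<inter> ?F \<and> v \<in> V}"
  let ?x = "monomial_vec p :: 'k ser_poly_vec"
  have subF: "is_submodule (K_tx m 0) ?F" by (rule is_submodule_strip)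
  have subI: "is_submodule (K_tx m 0) ?I"
    using I K_t_subset_K_tx[of m n] by (auto simp: is_submodule_def)
  have subV: "is_submodule (K_tx m 0) V"
    unfolding is_submodule_def
  proof (intro conjI ballI)
    show "0 \<in> V" using submodule_zero[OF subF] by (simp add: V_def)
  next
    fix u v assume "u \<in> V" "v \<in> V"
    then show "u + v \<in> V"
      using submodule_add[OF subF] monomials_add[of u v] unfolding V_def by blast
  next
    fix a :: "'k ser_poly" and v assume a: "a \<in> K_tx m 0" and v: "v \<in> V"
    have "gt p r" if "r \<in> monomials (smult_vec a v)" for r
    proof -
      from that monomials_smult_K_t[OF a, of v] obtain \<delta> q where r: "r = tshift \<delta> q"
        and \<delta>: "Poly_Mapping.keys \<delta> \<subseteq> {..<m}" and q: "q \<in> monomials v" by blast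
      have qM: "q \<in> vec_Mon m n s" "gt p q" using v q by (auto simp: V_def strip_iff)
      show ?thesis
      proof (cases "\<delta> = 0")
        case False
        then have "gt q r" unfolding r by (intro gt_tshift[OF ord loc qM(1) \<delta>])
        then show ?thesis
          using transp_onD[OF trans pM qM(1) _ qM(2)] tshift_vec_Mon[OF qM(1) \<delta>] r by blast
      qed (use qM r in simp)
    qed
    moreover have "smult_vec a v \<in> ?F" using subF a v by (simp add: is_submodule_def V_def)
    ultimately show "smult_vec a v \<in> V" by (simp add: V_def)
  qed
  have NI: "h + v \<in> N" if "h \<in> ?I" "h \<in> ?F" "v \<in> V" for h v
    unfolding N_def using that by blast
  have VN: "v \<in> N" if "v \<in> V" for v
    using NI[OF submodule_zero[OF I] submodule_zero[OF subF] that] by simp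
  have xF: "?x \<in> ?F" using pM by (simp add: strip_iff T_def)
  have "?x \<in> N"
  proof (rule strip_intersection_theorem)
    show "finite T" using T0(1) by (simp add: T_def)
    show "N \<subseteq> ?F" unfolding N_def V_def using submodule_add[OF subF] by blast
    show "is_submodule (K_tx m 0) N"
      unfolding is_submodule_def
    proof (intro conjI ballI)
      show "0 \<in> N" using VN submodule_zero[OF subV] by blast
    next
      fix u u' assume "u \<in> N" "u' \<in> N"
      then obtain h v h' v' where uu: "u = h + v" "u' = h' + v'"
        and "h \<in> ?I" "h \<in> ?F" "v \<in> V" "h' \<in> ?I" "h' \<in> ?F" "v' \<in> V" unfolding N_def by blast
      then have "(h + h') + (v + v') \<in> N"
        by (intro NI submodule_add[OF subI] submodule_add[OF subF] submodule_add[OF subV])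
      then show "u + u' \<in> N" unfolding uu by (simp add: algebra_simps)
    next
      fix a :: "'k ser_poly" and u assume a: "a \<in> K_tx m 0" and "u \<in> N"
      then obtain h v where u: "u = h + v" and "h \<in> ?I" "h \<in> ?F" "v \<in> V" unfolding N_def by blast
      then have "smult_vec a h + smult_vec a v \<in> N"
        using a subI subF subV by (intro NI) (auto simp: is_submodule_def)
      then show "smult_vec a u \<in> N" unfolding u smult_vec_add_right .
    qed
    show "?x \<in> ?F" by (rule xF)
  next
    fix i assume i: "i < m"
    let ?t = "Poly_Mapping.single i (1::nat)"
    let ?y = "smult_vec (tmon 1 ?t) ?x"
    have "?y \<in> ?F" using i xF by (intro submodule_tmon[OF subF]) auto
    moreover have "gt p q" if "q \<in> monomials ?y" for q
      using that monomials_tmon[of 1 ?t ?x] gt_tshift_single[OF ord loc pM i] by auto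
    ultimately show "?y \<in> N" by (intro VN) (auto simp: V_def)
  next
    fix d
    \<comment> \<open>An order exceeding the degree of \<open>p\<close> in \<open>t\<close>, so that the coefficient at \<open>p\<close> survives in \<open>h\<close>.\<close>
    define e where "e = max d (Suc (tdeg m (fst (fst p))))"
    obtain h where h: "h \<in> ?I" "place ` monomials h \<subseteq> T0" "f - h \<in> order_ge m e"
      using T0(2) by blast
    have hF: "h \<in> ?F" using h I_poly[OF h(1)] by (auto simp: strip_def T_def)
    have low: "vcoeff h q = vcoeff f q" if "tdeg m (fst (fst q)) < e" for q
    proof -
      have "q \<notin> monomials (f - h)" using that h(3) unfolding order_ge_def by fastforce
      then show ?thesis by (simp add: monomials_iff)
    qed
    define c where "c = vcoeff f p"
    have c: "c \<noteq> 0" using pf by (simp add: c_def monomials_iff)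
    let ?cx = "smult_vec (tmon c 0) ?x"
    have "h - ?cx \<in> {v + w | v w. v \<in> V \<and> w \<in> ?F \<inter> order_ge m e}" (is "_ \<in> ?S")
    proof (rule monomial_terms_in_imp_in)
      have SI: "v + w \<in> ?S" if "v \<in> V" "w \<in> ?F" "w \<in> order_ge m e" for v w
        using that by blast
      have 0: "0 \<in> V" "0 \<in> ?F" "0 \<in> order_ge m e" for e
        using submodule_zero[OF subV] submodule_zero[OF subF] by (auto simp: order_ge_def)
      have dF: "h - ?cx \<in> ?F"
        using hF xF by (intro submodule_diff[OF subF] submodule_tmon[OF subF]) auto
      then show "finite (monomials (h - ?cx))" by (simp add: strip_iff)
      show "0 \<in> ?S" using SI[OF 0] by simp
      show "u + u' \<in> ?S" if uS: "u \<in> ?S" "u' \<in> ?S" for u u'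
      proof -
        obtain v w v' w' where uu: "u = v + w" "u' = v' + w'" and
          "v \<in> V" "w \<in> ?F" "w \<in> order_ge m e" "v' \<in> V" "w' \<in> ?F" "w' \<in> order_ge m e"
          using uS by blast
        then have "(v + v') + (w + w') \<in> ?S"
          by (intro SI submodule_add[OF subV] submodule_add[OF subF] order_ge_add)
        moreover have "u + u' = (v + v') + (w + w')" unfolding uu by (simp add: algebra_simps)
        ultimately show ?thesis by metis
      qed
      fix q assume q: "q \<in> monomials (h - ?cx)"
      let ?term = "smult_vec (tmon (vcoeff (h - ?cx) q) 0) (monomial_vec q)"
      have "monomials ?term \<subseteq> {q}" by (auto simp: monomials_iff vcoeff_monomial_vec split: if_splits)
      moreover have "q \<in> vec_Mon m n s" "place q \<in> T" using dF q by (auto simp: strip_iff)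
      ultimately have tm: "monomials ?term \<subseteq> {q}" "?term \<in> ?F"
        by (auto simp: strip_iff intro: finite_subset)
      show "?term \<in> ?S"
      proof (cases "e \<le> tdeg m (fst (fst q))")
        case True
        then have "?term \<in> order_ge m e" using tm(1) by (auto simp: order_ge_def)
        then show ?thesis using SI[OF 0(1) tm(2)] by simp
      next
        case False
        then have "vcoeff (h - ?cx) q = vcoeff f q - c * (if q = p then 1 else 0)"
          using low by (simp add: vcoeff_monomial_vec)
        then have "q \<in> monomials f" "q \<noteq> p"
          using q by (auto simp: monomials_iff c_def split: if_splits)
        then have "gt p q" by (rule plead)
        then have "?term \<in> V" using tm by (auto simp: V_def)
        then show ?thesis using SI[OF _ 0(2,3)] by simp
      qed
    qed
    then obtain v w where v: "v \<in> V" and w: "w \<in> ?F" "w \<in> order_ge m e" and hvw: "h - ?cx = v + w" by blast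
    let ?s = "\<lambda>b. smult_vec (tmon b 0) :: 'k ser_poly_vec \<Rightarrow> _"
    have "?x = (?s (1 / c) h + ?s (- 1 / c) v) + ?s (- 1 / c) w"
    proof (rule vcoeff_inject)
      fix q
      have "vcoeff (h - ?cx) q = vcoeff (v + w) q" using hvw by simp
      then show "vcoeff ?x q = vcoeff ((?s (1 / c) h + ?s (- 1 / c) v) + ?s (- 1 / c) w) q"
        using c by (simp add: field_simps)
    qed
    moreover have "?s (1 / c) h + ?s (- 1 / c) v \<in> N"
      using h(1) hF v
      by (intro NI submodule_tmon[OF subI] submodule_tmon[OF subF] submodule_tmon[OF subV]) auto
    moreover have "?s (- 1 / c) w \<in> ?F" using w by (intro submodule_tmon[OF subF]) auto
    moreover have "?s (- 1 / c) w \<in> order_ge m d"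
    proof -
      have "w \<in> order_ge m d" using w(2) by (auto simp: order_ge_def e_def)
      then show ?thesis by (intro order_ge_smult) blast
    qed
    ultimately show "\<exists>u\<in>N. \<exists>w\<in>?F \<inter> order_ge m d. ?x = u + w" by blast
  qed
  then obtain h v where hv: "?x = h + v" and h: "h \<in> ?I" and v: "v \<in> V"
    unfolding N_def by blast
  have irr: "\<not> gt p p"
    using vec_monomial_orderingD(1)[OF ord] pM by (rule irreflp_onD)
  have hc: "vcoeff h q = (if q = p then 1 else 0) - vcoeff v q" for q
    using arg_cong[OF hv, of "\<lambda>u. vcoeff u q"] by (simp add: vcoeff_monomial_vec algebra_simps)
  have "vcoeff v p = 0" using v irr by (auto simp: V_def monomials_iff)
  then have "p \<in> monomials h" by (simp add: monomials_iff hc)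
  moreover have "gt p q" if "q \<in> monomials h" "q \<noteq> p" for q
    using that v by (auto simp: monomials_iff hc V_def)
  ultimately have "is_lead gt h p" by (simp add: is_lead_def)
  with h show ?thesis by blast
qed

text \<open>
  Passing from \<open>I\<close> to \<open>J\<close> adds no leading monomials, so even the sets of leading monomials agree.
\<close>
lemma leading_submodule_eq:
  fixes G :: "'k::field ser_poly_vec set"
  assumes ord: "vec_monomial_ordering m n s gt" and loc: "t_local m n s gt"
    and G: "G \<subseteq> free_module (K_tx m n) s"
  shows "leading_submodule m n gt (generated_submodule (R_x m n) G) =
         leading_submodule m n gt (generated_submodule (K_tx m n) G)"
    (is "leading_submodule m n gt ?J = leading_submodule m n gt ?I")
proof -
  have IJ: "?I \<subseteq> ?J" by (rule generated_submodule_mono[OF K_tx_subset_R_x])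
  note J = monomials_generated_submodule_R[OF G]
  have "lm gt f \<in> lm gt ` ?I" if f: "f \<in> ?J" for f
  proof (cases "f = 0")
    case True
    then show ?thesis using submodule_zero[OF is_submodule_generated] by blast
  next
    case False
    then obtain p where p: "is_lead gt f p" using lead_exists[OF ord loc] J[OF f] by blast
    then obtain h where h: "h \<in> ?I" "is_lead gt h p"
      using lead_in_polynomial_submodule[OF ord loc G f] by blast
    have "lm gt h = monomial_vec p" using h IJ by (intro lm_eq_monomial_vec[OF ord J]) auto
    moreover have "lm gt f = monomial_vec p" using p f by (intro lm_eq_monomial_vec[OF ord J])
    ultimately show ?thesis using h(1) by (metis imageI)
  qed
  with IJ have "lm gt ` ?J = lm gt ` ?I" by blast
  then show ?thesis by (simp add: leading_submodule_def)
qed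

theorem corollary4p7:
  fixes m n s :: nat
    and gt :: "vec_mon \<Rightarrow> vec_mon \<Rightarrow> bool"
    and G :: "'k::field ser_poly_vec set"
  assumes "vec_monomial_ordering m n s gt"
    and "t_local m n s gt"
    and "finite G"
    and "G \<subseteq> free_module (K_tx m n) s"
  shows "standard_basis m n gt (generated_submodule (K_tx m n) G) G \<longleftrightarrow>
         standard_basis m n gt (generated_submodule (R_x m n) G) G"
  unfolding standard_basis_def leading_submodule_eq[OF assms(1,2,4)]
  using generated_submodule_superset by blast

end
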